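(* Let $\mathbb{K}$ be an infinite field, or a finite field whose characteristic is $5$ or a prime $p\equiv 3 \pmod 4$. Then for every irreducible polynomial $P(t)\in\mathbb{K}[t]$ the $P(t)$-adic Littlewood Conjecture over $\mathbb{K}$ is false; that is, there exists a Laurent series $\Theta(t)\in\mathbb{K}((t^{-1}))$ such that $$\inf_{N(t)\in\mathbb{K}[t]\setminus\{0\}}|N(t)|\cdot|\langle N(t)\cdot\Theta(t)\rangle|\cdot|N(t)|_{P(t)}>0.$$
   Context: $\mathbb{K}((t^{-1}))$ is the field of formal Laurent series $\Theta(t)=\sum_{i\ge -h}a_it^{-i}$ in $t^{-1}$ with coefficients in $\mathbb{K}$. If $a_{-h}\neq0$ the degree of $\Theta$ is $\deg\Theta=h$ and $|\Theta(t)|=q^{\deg\Theta}$ (with $|0|=0$), where $q=\#\mathbb{K}$ if $\mathbb{K}$ is finite and $q=2$ if $\mathbb{K}$ is infinite. The fractional part is $\langle\Theta(t)\rangle=\sum_{i\ge1}a_it^{-i}$. For an irreducible polynomial $P(t)\in\mathbb{K}[t]$ and nonzero $N(t)\in\mathbb{K}[t]$, the $P(t)$-adic norm is $|N(t)|_{P(t)}=|P(t)|^{-i}=q^{-i\deg P}$, where $i=\max\{j\ge0:P(t)^j\mid N(t)\}$. The $P(t)$-adic Littlewood Conjecture over $\mathbb{K}$ asserts that the infimum $\inf_{N\in\mathbb{K}[t]\setminus\{0\}}|N|\cdot|\langle N\Theta\rangle|\cdot|N|_{P(t)}$ equals $0$ for every $\Theta\in\mathbb{K}((t^{-1}))$.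 *)

theory Defs
  imports "HOL-Computational_Algebra.Computational_Algebra"
begin

text \<open>
  The field of Laurent series in \<open>t\<^sup>-\<^sup>1\<close> is the library type \<^typ>\<open>'a fls\<close> with its formal variable
  \<^term>\<open>fls_X\<close> read as the inverse of \<open>t\<close>: the coefficient of \<open>t\<close> to the power \<open>-i\<close> in \<open>f\<close> is
  \<open>fls_nth f i\<close>. Hence \<open>t\<close> itself is \<^term>\<open>fls_X_inv\<close>, and the degree in \<open>t\<close> is the negative of
  \<^term>\<open>fls_subdegree\<close>.
\<close>

definition poly_to_laurent :: "'a::field poly \<Rightarrow> 'a fls" where
  "poly_to_laurent N = poly (map_poly fls_const N) fls_X_inv"

definition laurent_deg :: "'a::field fls \<Rightarrow> int" where
  "laurent_deg f = - fls_subdegree f"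

definition norm_base :: "'a::field itself \<Rightarrow> nat" where
  "norm_base _ = (if finite (UNIV :: 'a set) then card (UNIV :: 'a set) else 2)"

definition laurent_abs :: "'a::field fls \<Rightarrow> real" where
  "laurent_abs f = (if f = 0 then 0 else real (norm_base TYPE('a)) powi laurent_deg f)"

lift_definition laurent_frac :: "'a::field fls \<Rightarrow> 'a fls"
  is "\<lambda>f n. if n \<ge> 1 then f n else 0"
  by (auto intro: always_eventually)

text \<open>
  The library constant \<^const>\<open>multiplicity\<close> is not available for polynomials over an arbitrary
  \<^class>\<open>field\<close>: its sort constraint is too strong. The maximum below is over a finite set
  whenever \<open>P\<close> is irreducible and \<open>N\<close> is nonzero.
\<close>

definition adic_valuation :: "'a::field poly \<Rightarrow> 'a poly \<Rightarrow> nat" where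
  "adic_valuation P N = Max {j. P ^ j dvd N}"

text \<open>The adic norm is only used for \<^prop>\<open>N \<noteq> 0\<close>; the value at \<open>0\<close> is a convention.\<close>

definition adic_norm :: "'a::field poly \<Rightarrow> 'a poly \<Rightarrow> real" where
  "adic_norm P N =
     (if N = 0 then 0 else laurent_abs (poly_to_laurent P) powi (- int (adic_valuation P N)))"

definition littlewood_inf :: "'a::field poly \<Rightarrow> 'a fls \<Rightarrow> real" where
  "littlewood_inf P \<Theta> =
     (INF N\<in>{N. N \<noteq> 0}.
        laurent_abs (poly_to_laurent N) *
        laurent_abs (laurent_frac (poly_to_laurent N * \<Theta>)) *
        adic_norm P N)"

definition adic_littlewood_conjecture :: "'a::field poly \<Rightarrow> bool" where
  "adic_littlewood_conjecture P \<longleftrightarrow> (\<forall>\<Theta>. littlewood_inf P \<Theta> = 0)"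

lemma poly_to_laurent_pCons:
  "poly_to_laurent (pCons a N) = fls_const a + fls_X_inv * poly_to_laurent N"
  by (cases "a = 0 \<and> N = 0") (auto simp: poly_to_laurent_def map_poly_pCons)

lemma poly_to_laurent_nth:
  "fls_nth (poly_to_laurent N) n = (if n \<le> 0 then coeff N (nat (- n)) else 0)"
proof (induction N arbitrary: n)
  case 0
  show ?case by (simp add: poly_to_laurent_def)
next
  case (pCons a N)
  show ?case
  proof (cases "n < 0")
    case True
    then have "nat (- n) = Suc (nat (- (n + 1)))" by simp
    with True show ?thesis
      by (simp add: poly_to_laurent_pCons fls_X_inv_times_conv_shift pCons.IH)
  next
    case False
    then show ?thesis
      by (auto simp: poly_to_laurent_pCons fls_X_inv_times_conv_shift pCons.IH)
  qed
qed

lemma laurent_deg_poly_to_laurent: "laurent_deg (poly_to_laurent N) = int (degree N)"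
proof (cases "N = 0")
  case True
  then show ?thesis by (simp add: laurent_deg_def poly_to_laurent_def)
next
  case False
  have "fls_subdegree (poly_to_laurent N) = - int (degree N)"
    by (rule fls_subdegree_eqI) (use False in \<open>auto simp: poly_to_laurent_nth coeff_eq_0\<close>)
  then show ?thesis by (simp add: laurent_deg_def)
qed

lemma finite_adic_exponents:
  fixes P N :: "'a::field poly"
  assumes "irreducible P" "N \<noteq> 0"
  shows "finite {j. P ^ j dvd N}"
proof (rule finite_subset)
  have "P \<noteq> 0" "\<not> P dvd 1" using assms(1) by (auto simp: irreducible_def)
  then have deg: "degree P > 0" by (simp add: is_unit_iff_degree)
  show "{j. P ^ j dvd N} \<subseteq> {..degree N}"
  proof safe
    fix j assume "P ^ j dvd N"
    then have "degree (P ^ j) \<le> degree N" using assms(2) by (rule dvd_imp_degree_le)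
    then have "j * degree P \<le> degree N" using \<open>P \<noteq> 0\<close> by (simp add: degree_power_eq)
    moreover have "j * 1 \<le> j * degree P" using deg by (intro mult_left_mono) auto
    ultimately show "j \<le> degree N" by linarith
  qed
qed simp

lemma laurent_abs_nonneg: "laurent_abs f \<ge> 0"
  by (simp add: laurent_abs_def)

lemma adic_norm_nonneg: "adic_norm P N \<ge> 0"
  by (simp add: adic_norm_def laurent_abs_nonneg)

lemma littlewood_products_bdd_below:
  "bdd_below ((\<lambda>N. laurent_abs (poly_to_laurent N) *
     laurent_abs (laurent_frac (poly_to_laurent N * \<Theta>)) * adic_norm P N) ` A)"
  by (rule bdd_belowI[of _ 0]) (auto intro!: mult_nonneg_nonneg laurent_abs_nonneg adic_norm_nonneg)

end

theory Submission
  imports Defs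
begin

text \<open>
  It suffices to find \<open>\<Theta>\<close> such that the partial quotients of all \<open>t\<^sup>v \<Theta>\<close> have uniformly bounded degree:
  then \<open>\<Theta>(P(t))\<close> works for \<open>P\<close>, because writing \<open>N\<close> in base \<open>P\<close> splits \<open>N(t) \<Theta>(P(t))\<close> into pieces
  whose orders are distinct modulo the degree of \<open>P\<close>. Over an infinite field, choose the coefficients
  of \<open>\<Theta>\<close> one at a time so that no Hankel determinant vanishes.

  In odd characteristic \<open>p\<close>, put \<open>e = p - 1\<close> and \<open>\<Theta>(t) = \<Theta>(t\<^sup>2) + t\<^bsup>e-1\<^esup> / (t\<^sup>e + 1)\<close>; for \<open>p = 3\<close> this is
  the paperfolding series. Suppose that a reduced fraction \<open>R / Q\<close> satisfies
  \<open>|Q| |Q t\<^sup>v \<Theta> - R| < q\<^bsup>-2m\<^esup>\<close>, where \<open>m\<close> is the number of \<open>x\<close> in the multiplicative group of the prime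
  field with \<open>Q(x) \<noteq> 0\<close>. Comparing \<open>R / Q\<close> with its image under \<open>t \<mapsto> -t\<close> gives a polynomial with more
  zeros than its degree, hence the zero polynomial. Therefore \<open>t\<^sup>e + 1\<close> divides \<open>Q(t) Q(-t)\<close>, hence \<open>Q(t)\<close>, as
  the Frobenius map exchanges \<open>Q(t)\<close> and \<open>Q(-t)\<close> modulo \<open>t\<^sup>e + 1\<close>; moreover
  \<open>R / Q - t\<^bsup>v+e-1\<^esup> / (t\<^sup>e + 1)\<close> is even or odd. It therefore comes, by \<open>t \<mapsto> t\<^sup>2\<close>, from a fraction of smaller
  degree that approximates some \<open>t\<^sup>w \<Theta>\<close>, and the count of nonzeros shows that this fraction satisfies
  the same inequality: infinite descent.
\<close>

section \<open>Laurent series in \<open>t\<^sup>-\<^sup>1\<close> and substitution of polynomials\<close>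

lemma poly_to_laurent_0 [simp]: "poly_to_laurent 0 = 0"
  by (simp add: poly_to_laurent_def)

lemma poly_to_laurent_add [simp]:
  "poly_to_laurent (P + Q) = poly_to_laurent P + poly_to_laurent Q"
  by (rule fls_eqI) (simp add: poly_to_laurent_nth)

lemma poly_to_laurent_uminus [simp]: "poly_to_laurent (- P) = - poly_to_laurent P"
  by (rule fls_eqI) (simp add: poly_to_laurent_nth)

lemma poly_to_laurent_diff [simp]:
  "poly_to_laurent (P - Q) = poly_to_laurent P - poly_to_laurent Q"
  by (rule fls_eqI) (simp add: poly_to_laurent_nth)

lemma poly_to_laurent_smult [simp]:
  "poly_to_laurent (smult c P) = fls_const c * poly_to_laurent P"
  by (rule fls_eqI) (simp add: poly_to_laurent_nth)

lemma poly_to_laurent_mult [simp]: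
  "poly_to_laurent (P * Q) = poly_to_laurent P * poly_to_laurent Q"
  by (induction P) (simp_all add: poly_to_laurent_pCons algebra_simps)

lemma poly_to_laurent_1 [simp]: "poly_to_laurent 1 = 1"
  by (simp add: poly_to_laurent_def)

lemma poly_to_laurent_2: "poly_to_laurent 2 = 2"
  unfolding one_add_one[symmetric] poly_to_laurent_add poly_to_laurent_1 ..

lemma poly_to_laurent_power [simp]: "poly_to_laurent (P ^ n) = poly_to_laurent P ^ n"
  by (induction n) simp_all

lemma poly_to_laurent_sum [simp]:
  "poly_to_laurent (sum f A) = (\<Sum>x\<in>A. poly_to_laurent (f x))"
  by (induction A rule: infinite_finite_induct) simp_all

lemma poly_to_laurent_monom: "poly_to_laurent (monom c n) = fls_const c * fls_X_inv ^ n"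
  by (induction n) (simp_all add: monom_0 monom_Suc poly_to_laurent_pCons algebra_simps)

lemma fls_subdegree_poly_to_laurent [simp]:
  "fls_subdegree (poly_to_laurent N) = - int (degree N)"
  using laurent_deg_poly_to_laurent[of N] by (simp add: laurent_deg_def)

lemma poly_to_laurent_eq_0_iff [simp]: "poly_to_laurent P = 0 \<longleftrightarrow> P = 0"
proof
  assume "poly_to_laurent P = 0"
  then have "coeff P n = 0" for n
    using poly_to_laurent_nth[of P "- int n"] by simp
  then show "P = 0" by (simp add: poly_eq_iff)
qed simp

text \<open>Replaces t by T(t). As \<open>fls_X\<close> stands for 1/t, it is replaced by 1/T(t).
  For nonconstant \<open>T\<close> this is a power series in 1/t without constant term, so
  \<open>fls_regpart\<close> loses nothing.\<close>

definition laurent_subst :: "'a::field poly \<Rightarrow> 'a fls \<Rightarrow> 'a fls" where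
  "laurent_subst T f = fls_compose_fps f (fls_regpart (inverse (poly_to_laurent T)))"

context
  fixes T :: "'a::field poly"
  assumes T: "degree T > 0"
begin

lemma laurent_subst_aux:
  "fps_to_fls (fls_regpart (inverse (poly_to_laurent T))) = inverse (poly_to_laurent T)"
  "fls_regpart (inverse (poly_to_laurent T)) \<noteq> 0"
  "fps_nth (fls_regpart (inverse (poly_to_laurent T))) 0 = 0"
  "subdegree (fls_regpart (inverse (poly_to_laurent T))) = degree T"
proof -
  let ?g = "fls_regpart (inverse (poly_to_laurent T))"
  show 1: "fps_to_fls ?g = inverse (poly_to_laurent T)" by simp
  have "T \<noteq> 0" using T by auto
  with 1 show "?g \<noteq> 0"
    by (metis fps_zero_to_fls nonzero_imp_inverse_nonzero poly_to_laurent_eq_0_iff)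
  have "int (subdegree ?g) = fls_subdegree (fps_to_fls ?g)"
    by (simp only: fls_subdegree_fls_to_fps)
  also have "\<dots> = int (degree T)" unfolding 1 by simp
  finally show 2: "subdegree ?g = degree T" by simp
  show "fps_nth ?g 0 = 0" using 2 T nth_less_subdegree_zero[of 0 ?g] by simp
qed

lemmas laurent_subst_add = fls_compose_fps_add[OF laurent_subst_aux(2,3), folded laurent_subst_def]
lemmas laurent_subst_diff = fls_compose_fps_diff[OF laurent_subst_aux(2,3), folded laurent_subst_def]
lemmas laurent_subst_mult = fls_compose_fps_mult[OF laurent_subst_aux(2,3), folded laurent_subst_def]
lemmas laurent_subst_power = fls_compose_fps_power[OF laurent_subst_aux(2,3), folded laurent_subst_def]
lemmas laurent_subst_eq_0_iff = fls_compose_fps_eq_0_iff[OF laurent_subst_aux(2,3), folded laurent_subst_def]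
lemmas laurent_subst_inverse = fls_compose_fps_inverse[OF laurent_subst_aux(2,3), folded laurent_subst_def]

lemma laurent_subst_0 [simp]: "laurent_subst T 0 = 0"
  by (simp add: laurent_subst_def)

lemma laurent_subst_const [simp]: "laurent_subst T (fls_const c) = fls_const c"
  by (simp add: laurent_subst_def)

lemma fls_subdegree_laurent_subst:
  "fls_subdegree (laurent_subst T f) = int (degree T) * fls_subdegree f"
  unfolding laurent_subst_def
  by (simp only: subdegree_fls_compose_fps[OF laurent_subst_aux(3)] laurent_subst_aux(4) mult.commute)

lemma laurent_subst_X_inv [simp]: "laurent_subst T fls_X_inv = poly_to_laurent T"
proof -
  have "laurent_subst T fls_X = inverse (poly_to_laurent T)"
    by (simp add: laurent_subst_def laurent_subst_aux)
  then show ?thesis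
    using laurent_subst_inverse[of fls_X] by (simp add: fls_inverse_X)
qed

lemma laurent_subst_poly: "laurent_subst T (poly_to_laurent Q) = poly_to_laurent (pcompose Q T)"
  by (induction Q)
     (simp_all add: poly_to_laurent_pCons pcompose_pCons laurent_subst_add laurent_subst_mult)

end

lemma laurent_subst_subst:
  fixes S T :: "'a::field poly"
  assumes S: "degree S > 0" and T: "degree T > 0"
  shows "laurent_subst T (laurent_subst S f) = laurent_subst (pcompose S T) f"
proof -
  let ?G = "\<lambda>T. fls_regpart (inverse (poly_to_laurent T))"
  have ST: "degree (pcompose S T) > 0" using S T by (simp add: degree_pcompose)
  have "fps_to_fls (fps_compose (?G S) (?G T)) = laurent_subst T (fps_to_fls (?G S))"
    unfolding laurent_subst_def
    by (rule fls_compose_fps_to_fls[symmetric, OF laurent_subst_aux(2,3)[OF T]])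
  also have "\<dots> = inverse (poly_to_laurent (pcompose S T))"
    by (simp only: laurent_subst_aux(1)[OF S] laurent_subst_inverse[OF T] laurent_subst_poly[OF T])
  finally have "fps_compose (?G S) (?G T) = ?G (pcompose S T)"
    using fps_to_fls_eq_iff laurent_subst_aux(1)[OF ST] by metis
  then show ?thesis
    unfolding laurent_subst_def
    by (simp only: fls_compose_fps_assoc[OF laurent_subst_aux(2,3)[OF S] laurent_subst_aux(2,3)[OF T]])
qed

section \<open>Polynomials over a field\<close>

text \<open>A nonzero element \<open>h\<close> of least degree in the ideal generated by
  \<open>f\<close> and \<open>g\<close> divides the whole ideal, by division with remainder.
  Cancelling \<open>h\<close> in its own representation gives the Bezout identity of the
  cofactors.\<close>

lemma bezout_poly_reduce:
  fixes f g :: "'a::field poly"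
  assumes "g \<noteq> 0"
  obtains h f' g' u v where "f = h * f'" "g = h * g'" "u * f' + v * g' = 1"
proof -
  define I where "I = {d. d \<noteq> 0 \<and> (\<exists>u v. d = u * f + v * g)}"
  have "g \<in> I" using assms by (auto simp: I_def intro: exI[of _ 0] exI[of _ 1])
  then obtain h where h: "h \<in> I" "\<And>d. d \<in> I \<Longrightarrow> degree h \<le> degree d"
    using exists_least_iff[of "\<lambda>n. \<exists>d\<in>I. degree d = n"] by (metis linorder_not_le)
  then obtain u v where uv: "h = u * f + v * g" and h0: "h \<noteq> 0" by (auto simp: I_def)
  have dvd: "h dvd u' * f + v' * g" for u' v'
  proof (rule ccontr)
    let ?x = "u' * f + v' * g"
    assume "\<not> h dvd ?x"
    then have m: "?x mod h \<noteq> 0" by (simp add: dvd_eq_mod_eq_0)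
    have "?x mod h = ?x - (?x div h) * h" by (simp add: minus_div_mult_eq_mod)
    also have "\<dots> = (u' - (?x div h) * u) * f + (v' - (?x div h) * v) * g"
      unfolding uv by (simp add: algebra_simps)
    finally have "?x mod h \<in> I" using m by (auto simp: I_def)
    with h(2) have "degree h \<le> degree (?x mod h)" by blast
    with degree_mod_less[OF h0, of ?x] m show False by auto
  qed
  from dvd[of 1 0] dvd[of 0 1] obtain f' g' where fg: "f = h * f'" "g = h * g'"
    by (auto elim!: dvdE)
  have "h * (u * f' + v * g') = h * 1" using uv fg by (simp add: algebra_simps)
  with h0 have "u * f' + v * g' = 1" by (simp only: mult_cancel_left) auto
  with fg that show ?thesis by blast
qed

lemma coprime_poly_bezout:
  fixes f g :: "'a::field poly"
  assumes "coprime f g" "g \<noteq> 0"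
  obtains u v where "u * f + v * g = 1"
proof -
  obtain h f' g' u v where *: "f = h * f'" "g = h * g'" "u * f' + v * g' = 1"
    using bezout_poly_reduce[OF assms(2)] by metis
  then have "h dvd 1" using assms(1) by (auto simp: coprime_def)
  then obtain k where "1 = h * k" by (auto elim: dvdE)
  have "(k * u) * f + (k * v) * g = (h * k) * (u * f' + v * g')"
    unfolding *(1,2) by (simp add: algebra_simps)
  then have "(k * u) * f + (k * v) * g = 1" using *(3) \<open>1 = h * k\<close> by simp
  with that show ?thesis by blast
qed

lemma bezout_imp_coprime:
  fixes f g :: "'a::field poly"
  assumes "u * f + v * g = 1"
  shows "coprime f g"
  by (rule coprimeI) (metis assms dvd_add dvd_mult)

lemma coprime_poly_dvd_mult:
  fixes f g :: "'a::field poly"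
  assumes "coprime f g" "g \<noteq> 0" "g dvd f * x"
  shows "g dvd x"
proof -
  obtain u v where "u * f + v * g = 1" using coprime_poly_bezout[OF assms(1,2)] .
  then have "x = u * (f * x) + g * (v * x)"
    by (metis (no_types, opaque_lifting) distrib_right mult.assoc mult.commute mult_1)
  then show ?thesis using assms(3) by (metis dvd_add dvd_mult dvd_triv_left)
qed

lemma coprime_poly_roots:
  fixes f g :: "'a::field poly"
  assumes "coprime f g" "poly f x = 0"
  shows "poly g x \<noteq> 0"
proof
  assume "poly g x = 0"
  with assms have "[:-x, 1:] dvd f" "[:-x, 1:] dvd g" by (simp_all add: poly_eq_0_iff_dvd)
  with assms(1) have "is_unit [:-x, 1:]" by (auto simp: coprime_def)
  then show False by (simp add: is_unit_iff_degree)
qed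

text \<open>Substitution respects congruences; the case of interest is that t^p and -t are congruent
  modulo t^e + 1.\<close>

lemma pcompose_diff_dvd:
  fixes f g Q :: "'a::comm_ring_1 poly"
  shows "(f - g) dvd (pcompose Q f - pcompose Q g)"
proof (induction Q)
  case (pCons a Q)
  have "pcompose (pCons a Q) f - pcompose (pCons a Q) g =
      f * (pcompose Q f - pcompose Q g) + (f - g) * pcompose Q g"
    by (simp add: pcompose_pCons algebra_simps)
  then show ?case using pCons.IH by (metis dvd_add dvd_mult dvd_triv_left)
qed simp

section \<open>The substitutions t -> t^2 and t -> -t, and the parity of polynomials\<close>

definition poly_sq :: "'a::comm_ring_1 poly \<Rightarrow> 'a poly" where
  "poly_sq Q = pcompose Q (monom 1 2)"

definition poly_reflect :: "'a::comm_ring_1 poly \<Rightarrow> 'a poly" where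
  "poly_reflect Q = pcompose Q [:0, -1:]"

lemma poly_reflect_simps [simp]:
  "poly_reflect 0 = 0" "poly_reflect 1 = 1" "poly_reflect [:c:] = [:c:]"
  "poly_reflect (P + Q) = poly_reflect P + poly_reflect Q"
  "poly_reflect (P - Q) = poly_reflect P - poly_reflect Q"
  "poly_reflect (- P) = - poly_reflect P"
  "poly_reflect (P * Q) = poly_reflect P * poly_reflect Q"
  "poly_reflect (smult c P) = smult c (poly_reflect P)"
  by (simp_all add: poly_reflect_def pcompose_add pcompose_diff pcompose_uminus pcompose_mult
      pcompose_smult pcompose_1)

lemma poly_sq_simps [simp]:
  "poly_sq 0 = 0" "poly_sq 1 = 1" "poly_sq [:c:] = [:c:]"
  "poly_sq (P + Q) = poly_sq P + poly_sq Q"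
  "poly_sq (P - Q) = poly_sq P - poly_sq Q"
  "poly_sq (- P) = - poly_sq P"
  "poly_sq (P * Q) = poly_sq P * poly_sq Q"
  by (simp_all add: poly_sq_def pcompose_add pcompose_diff pcompose_uminus pcompose_mult
      pcompose_1)

lemma poly_reflect_power [simp]: "poly_reflect (P ^ n) = poly_reflect P ^ n"
  by (induction n) simp_all

lemma poly_reflect_reflect [simp]: "poly_reflect (poly_reflect Q) = Q"
  by (simp add: poly_reflect_def pcompose_assoc[symmetric] pcompose_pCons)

lemma poly_reflect_sq [simp]: "poly_reflect (poly_sq Q) = poly_sq Q"
  by (simp add: poly_reflect_def poly_sq_def pcompose_assoc[symmetric] pcompose_pCons monom_altdef
      pcompose_mult power2_eq_square)

lemma poly_reflect_monom [simp]: "poly_reflect (monom c n) = monom ((-1) ^ n * c) n"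
  by (induction n) (simp_all add: monom_0 monom_Suc poly_reflect_def pcompose_pCons minus_monom)

lemma coeff_poly_reflect: "coeff (poly_reflect Q) n = (-1) ^ n * coeff Q n"
  by (simp add: poly_reflect_def coeff_pcompose_linear)

lemma poly_poly_reflect [simp]: "poly (poly_reflect Q) x = poly Q (- x)"
  by (simp add: poly_reflect_def poly_pcompose)

lemma poly_poly_sq [simp]: "poly (poly_sq Q) x = poly Q (x ^ 2)"
  by (simp add: poly_sq_def poly_pcompose poly_monom)

lemma degree_poly_sq [simp]: "degree (poly_sq (Q :: 'a::idom poly)) = 2 * degree Q"
  by (simp add: poly_sq_def degree_pcompose degree_monom_eq)

lemma degree_poly_reflect [simp]: "degree (poly_reflect (Q :: 'a::idom poly)) = degree Q"
  by (simp add: poly_reflect_def degree_pcompose)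

lemma poly_sq_monom: "poly_sq (monom 1 d) = monom 1 (2 * d)"
  by (induction d) (simp_all add: monom_0 monom_Suc poly_sq_def pcompose_pCons numeral_2_eq_2)

lemma poly_even_odd_parts:
  obtains Q0 Q1 where "Q = poly_sq Q0 + [:0, 1:] * poly_sq Q1"
proof (induction Q arbitrary: thesis)
  case 0
  show ?case by (rule 0[of 0 0]) simp
next
  case (pCons a Q)
  obtain Q0 Q1 where "Q = poly_sq Q0 + [:0, 1:] * poly_sq Q1" using pCons(2) .
  \<comment> \<open>Multiplication by t interchanges the even and the odd part.\<close>
  then have "pCons a Q = poly_sq (pCons a Q1) + [:0, 1:] * poly_sq Q0"
    by (simp add: poly_sq_def pcompose_pCons monom_Suc numeral_2_eq_2)
  then show ?case by (rule pCons)
qed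

lemma coeff_poly_sq: "coeff (poly_sq Q) n = (if even n then coeff Q (n div 2) else 0)"
proof (induction Q arbitrary: n)
  case (pCons a Q)
  have *: "poly_sq (pCons a Q) = pCons a (pCons 0 (poly_sq Q))"
    by (simp add: poly_sq_def pcompose_pCons monom_Suc numeral_2_eq_2)
  show ?case
  proof (cases n)
    case (Suc k)
    then show ?thesis by (cases k) (auto simp: * pCons.IH)
  qed (simp add: *)
qed simp

lemma coeff_even_odd:
  "coeff (poly_sq Q0 + [:0, 1:] * poly_sq Q1) (2 * n) = coeff Q0 n"
  "coeff (poly_sq Q0 + [:0, 1:] * poly_sq Q1) (Suc (2 * n)) = coeff Q1 n"
  by (cases n; simp add: coeff_poly_sq)+

lemma even_odd_parts_unique:
  assumes "poly_sq P0 + [:0, 1:] * poly_sq P1 = poly_sq Q0 + [:0, 1:] * poly_sq Q1"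
  shows "P0 = Q0" "P1 = Q1"
  using assms by (metis coeff_even_odd poly_eq_iff)+

lemma degree_even_odd:
  assumes "h = poly_sq h0 + [:0, 1:] * poly_sq h1"
  shows "2 * degree h0 \<le> degree h" "2 * degree h1 \<le> degree h"
proof -
  have "h0 \<noteq> 0 \<Longrightarrow> 2 * degree h0 \<le> degree h"
    by (rule le_degree) (simp only: assms coeff_even_odd leading_coeff_0_iff not_False_eq_True)
  then show "2 * degree h0 \<le> degree h" by (cases "h0 = 0") auto
  have "h1 \<noteq> 0 \<Longrightarrow> Suc (2 * degree h1) \<le> degree h"
    by (rule le_degree) (simp only: assms coeff_even_odd leading_coeff_0_iff not_False_eq_True)
  then show "2 * degree h1 \<le> degree h" by (cases "h1 = 0") auto
qed

text \<open>Reflection negates the odd part and fixes the even part, so one of them equals its own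
  negative and vanishes because 2 is nonzero.\<close>

lemma poly_parity_cases:
  fixes Q :: "'a::field poly"
  assumes "poly_reflect Q = smult ((-1) ^ k) Q" "(2::'a) \<noteq> 0"
  obtains B where "Q = (if even k then poly_sq B else [:0, 1:] * poly_sq B)"
proof -
  obtain Q0 Q1 where Q: "Q = poly_sq Q0 + [:0, 1:] * poly_sq Q1" using poly_even_odd_parts .
  have refl: "poly_reflect Q = poly_sq Q0 + [:0, 1:] * poly_sq (- Q1)"
    unfolding Q poly_reflect_simps poly_reflect_sq by (simp add: poly_reflect_def pcompose_pCons)
  have uminus: "x = 0" if "x = - x" for x :: "'a poly"
  proof -
    from that have "x + x = 0" by (metis add.right_inverse)
    then have "coeff x n + coeff x n = 0" for n by (metis coeff_0 coeff_add)
    then have "2 * coeff x n = 0" for n by (simp only: mult_2)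
    with assms(2) show ?thesis by (simp add: poly_eq_iff)
  qed
  show ?thesis
  proof (cases "even k")
    case True
    then have "poly_sq Q0 + [:0, 1:] * poly_sq Q1 = poly_sq Q0 + [:0, 1:] * poly_sq (- Q1)"
      using assms(1) refl Q by simp
    then have "Q1 = - Q1" by (rule even_odd_parts_unique)
    then have "Q1 = 0" by (rule uminus)
    then show ?thesis using True Q that[of Q0] by simp
  next
    case False
    then have "poly_sq (- Q0) + [:0, 1:] * poly_sq (- Q1) = poly_sq Q0 + [:0, 1:] * poly_sq (- Q1)"
      using assms(1) refl Q by simp
    then have "- Q0 = Q0" by (rule even_odd_parts_unique)
    then have "Q0 = 0" using uminus[of Q0] by simp
    then show ?thesis using False Q that[of Q1] by simp
  qed
qed

section \<open>Orders in 1/t and approximation by fractions\<close>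

definition fls_order_ge :: "int \<Rightarrow> 'a::field fls \<Rightarrow> bool" where
  "fls_order_ge k f \<longleftrightarrow> f = 0 \<or> k \<le> fls_subdegree f"

text \<open>The separate clause for zero in \<open>fls_order_ge\<close> is what makes this true:
  \<open>fls_subdegree\<close> is 0 there, while the order ought to be infinite.\<close>

lemma fls_order_ge_iff_nth: "fls_order_ge k f \<longleftrightarrow> (\<forall>n<k. fls_nth f n = 0)"
proof
  assume "\<forall>n<k. fls_nth f n = 0"
  then show "fls_order_ge k f"
    unfolding fls_order_ge_def by (metis linorder_not_le nth_fls_subdegree_zero_iff)
qed (auto simp: fls_order_ge_def)

lemma fls_order_ge_diff: "fls_order_ge k f \<Longrightarrow> fls_order_ge k g \<Longrightarrow> fls_order_ge k (f - g)"
  by (simp add: fls_order_ge_iff_nth)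

lemma fls_order_ge_mono: "fls_order_ge k f \<Longrightarrow> l \<le> k \<Longrightarrow> fls_order_ge l f"
  by (auto simp: fls_order_ge_def)

lemma fls_order_ge_mult:
  "fls_order_ge k f \<Longrightarrow> fls_order_ge l g \<Longrightarrow> fls_order_ge (k + l) (f * g)"
  by (cases "f = 0 \<or> g = 0") (auto simp: fls_order_ge_def)

lemma fls_order_ge_poly: "fls_order_ge (- int (degree Q)) (poly_to_laurent Q)"
  by (simp add: fls_order_ge_def)

lemma fls_order_ge_poly_iff:
  "fls_order_ge k (poly_to_laurent Q) \<longleftrightarrow> Q = 0 \<or> int (degree Q) \<le> - k"
  by (auto simp: fls_order_ge_def)

lemma fls_order_ge_subst_iff:
  assumes "degree T > 0"
  shows "fls_order_ge (int (degree T) * k) (laurent_subst T f) \<longleftrightarrow> fls_order_ge k f"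
  using assms
  by (auto simp: fls_order_ge_def laurent_subst_eq_0_iff fls_subdegree_laurent_subst)

text \<open>The cross difference \<open>Q1 * R2 - Q2 * R1\<close> is a polynomial of positive order
  in 1/t, hence zero.\<close>

lemma good_fractions_equal:
  assumes "fls_order_ge (int (degree Q2) + 1) (poly_to_laurent Q1 * \<alpha> - poly_to_laurent R1)"
    and "fls_order_ge (int (degree Q1) + 1) (poly_to_laurent Q2 * \<alpha> - poly_to_laurent R2)"
  shows "Q1 * R2 = Q2 * R1"
proof -
  have "poly_to_laurent (Q1 * R2 - Q2 * R1) =
      poly_to_laurent Q2 * (poly_to_laurent Q1 * \<alpha> - poly_to_laurent R1) -
      poly_to_laurent Q1 * (poly_to_laurent Q2 * \<alpha> - poly_to_laurent R2)"
    by (simp add: algebra_simps)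
  also have "fls_order_ge 1 \<dots>"
    using fls_order_ge_mult[OF fls_order_ge_poly[of Q2] assms(1)]
      fls_order_ge_mult[OF fls_order_ge_poly[of Q1] assms(2)]
    by (intro fls_order_ge_diff) simp_all
  finally show ?thesis unfolding fls_order_ge_poly_iff by auto
qed

text \<open>Eliminates \<open>T\<close> between an approximation error and its reflection. It is
  applied with \<open>t\<close> as t^v, \<open>s\<close> as (-1)^v, \<open>N\<close> as Q(-t) and
  \<open>R'\<close> as R(-t), where the reflection of \<open>T\<close> is
  \<open>T - 2 * h\<close>.\<close>

lemma wronskian_identity:
  fixes s r Q R R' N t h T :: "'b::comm_ring_1"
  assumes s: "s * s = 1"
  shows "r * (s * Q * R' - N * R) + 2 * Q * N * (t * (r * h)) =
    r * (N * (Q * (t * T) - R) - s * Q * (N * (s * t * (T - 2 * h)) - R'))"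
proof -
  have "r * (N * (Q * (t * T) - R) - s * Q * (N * (s * t * (T - 2 * h)) - R')) =
      r * (N * Q * t * T - N * R - (s * s) * (Q * N * t * (T - 2 * h)) + s * Q * R')"
    by (simp add: algebra_simps)
  also have "\<dots> = r * (s * Q * R' - N * R) + 2 * Q * N * (t * (r * h))"
    unfolding s by (simp add: algebra_simps)
  finally show ?thesis ..
qed

section \<open>A series in odd characteristic\<close>

locale paperfolding =
  fixes p e d :: nat and h \<Theta> :: "'a::field fls"
  assumes p: "prime p" "odd p" "CHAR('a) = p" and p_eq: "p = Suc e" and e_eq: "e = 2 * d"
    and h: "poly_to_laurent (monom 1 e + 1) * h = poly_to_laurent (monom 1 (e - 1))"
    and Theta: "\<Theta> = laurent_subst (monom 1 2) \<Theta> + h"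
    and Theta_order: "fls_order_ge 1 \<Theta>"
begin

definition r :: "'a poly" where "r = monom 1 e + 1"

lemma e_even: "even e" and e_ge: "e \<ge> 2"
  using p prime_gt_1_nat[OF p(1)] by (auto simp: p_eq elim!: oddE)

lemma rh: "poly_to_laurent r * h = fls_X_inv ^ (e - 1)"
  using h unfolding r_def by (simp add: poly_to_laurent_monom)

lemma degree_r: "degree r = e"
  using e_ge by (simp add: r_def degree_add_eq_left degree_monom_eq)

lemma r_nz: "r \<noteq> 0"
  using degree_r e_ge by auto

lemma r_reflect [simp]: "poly_reflect r = r"
  using e_even by (simp add: r_def)

lemma two_nz: "(2::'a) \<noteq> 0"
proof
  assume "(2::'a) = 0"
  then have "CHAR('a) dvd 2" using of_nat_eq_0_iff_char_dvd[of 2, where 'a='a] by simp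
  then have "p \<le> 2" using p(3) by (auto dest: dvd_imp_le)
  then show False using e_ge p_eq by simp
qed

section \<open>Frobenius and reflection acting on \<open>h\<close> and
  \<open>\<Theta>\<close>\<close>

lemma frob_add_fls: "(x + y) ^ p = x ^ p + (y ^ p :: 'a fls)"
  using p by (intro freshmans_dream) auto

lemma frob_diff_fls: "(x - y) ^ p = x ^ p - (y ^ p :: 'a fls)"
  using frob_add_fls[of x "-y"] p by simp

lemma frob_add_poly: "(x + y) ^ p = x ^ p + (y ^ p :: 'a poly)"
  using p by (intro freshmans_dream) auto

definition frob :: "'a poly \<Rightarrow> 'a poly" where "frob Q = map_poly (\<lambda>c. c ^ p) Q"

lemma p_pos: "p > 0" using p_eq by simp

lemma degree_frob [simp]: "degree (frob Q) = degree Q"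
  unfolding frob_def using p_pos by (intro degree_map_poly) auto

lemma frob_eq_0_iff [simp]: "frob Q = 0 \<longleftrightarrow> Q = 0"
  unfolding frob_def using p_pos by (intro map_poly_eq_0_iff) auto

lemma frob_pcompose: "pcompose (frob Q) (monom 1 p) = Q ^ p"
proof (induction Q)
  case 0
  then show ?case using p_pos by (simp add: frob_def)
next
  case (pCons a Q)
  have "pCons a Q ^ p = ([:a:] + [:0, 1:] * Q) ^ p" by simp
  also have "\<dots> = [:a ^ p:] + monom 1 p * Q ^ p"
    unfolding frob_add_poly power_mult_distrib poly_const_pow by (simp add: monom_altdef)
  also have "\<dots> = pcompose (frob (pCons a Q)) (monom 1 p)"
    using p_pos by (simp add: frob_def map_poly_pCons pcompose_pCons pCons.IH[unfolded frob_def])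
  finally show ?case ..
qed

lemma degree_monom_pos: "degree (monom (1::'a) p) > 0" "degree (monom (1::'a) 2) > 0"
  using p_pos by (simp_all add: degree_monom_eq)

lemma monom_pcompose: "pcompose (monom 1 n) (monom 1 k) = (monom 1 (k * n) :: 'a poly)"
  by (induction n)
    (simp_all add: monom_0 monom_Suc pcompose_pCons mult_monom)

lemma r_pcompose: "pcompose r (monom 1 p) = r ^ p"
  unfolding r_def frob_add_poly
  by (simp add: pcompose_add monom_pcompose pcompose_1 monom_power mult.commute)

text \<open>Since r(t^p) = r^p, both sides agree after multiplication by
  \<open>r ^ p\<close>.\<close>

lemma h_frob: "h ^ p = laurent_subst (monom 1 p) h"
proof -
  have "poly_to_laurent (r ^ p) * laurent_subst (monom 1 p) h =
      laurent_subst (monom 1 p) (poly_to_laurent r * h)"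
    by (simp add: laurent_subst_mult degree_monom_pos laurent_subst_poly r_pcompose)
  also have "\<dots> = (fls_X_inv ^ (e - 1)) ^ p"
    unfolding rh
    by (simp add: degree_monom_pos laurent_subst_power poly_to_laurent_monom mult.commute
        flip: power_mult)
  also have "\<dots> = poly_to_laurent (r ^ p) * h ^ p"
    unfolding rh[symmetric] by (simp add: power_mult_distrib)
  finally show ?thesis using r_nz by simp
qed

text \<open>The difference of the two sides is invariant under t -> t^2. This substitution doubles
  orders, so a nonzero invariant series has order 0, whereas here the order is at least
  \<open>p\<close>.\<close>

lemma Theta_frob: "\<Theta> ^ p = laurent_subst (monom 1 p) \<Theta>"
proof -
  define \<Delta> where "\<Delta> = \<Theta> ^ p - laurent_subst (monom 1 p) \<Theta>"
  have T2: "laurent_subst (monom 1 2) \<Theta> = \<Theta> - h" using Theta by (simp add: algebra_simps)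
  have "laurent_subst (monom 1 2) (laurent_subst (monom 1 p) \<Theta>) =
      laurent_subst (monom 1 p) (laurent_subst (monom 1 2) \<Theta>)"
    by (simp add: laurent_subst_subst degree_monom_pos monom_pcompose mult.commute)
  then have "laurent_subst (monom 1 2) \<Delta> = \<Delta>"
    unfolding \<Delta>_def
    by (simp add: laurent_subst_diff laurent_subst_power degree_monom_pos T2 frob_diff_fls h_frob)
  then have "2 * fls_subdegree \<Delta> = fls_subdegree \<Delta>"
    using fls_subdegree_laurent_subst[OF degree_monom_pos(2), of \<Delta>] by (simp add: degree_monom_eq)
  moreover have "fls_order_ge (int p) (\<Theta> ^ p)"
    using Theta_order by (auto simp: fls_order_ge_def fls_subdegree_pow p_pos)
  moreover have "fls_order_ge (int p * 1) (laurent_subst (monom 1 p) \<Theta>)"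
    using fls_order_ge_subst_iff[OF degree_monom_pos(1), of 1 \<Theta>] Theta_order
    by (simp add: degree_monom_eq)
  ultimately have "\<Delta> = 0"
    using fls_order_ge_diff[of "int p" "\<Theta> ^ p" "laurent_subst (monom 1 p) \<Theta>"] p_pos
    unfolding \<Delta>_def fls_order_ge_def by auto
  then show ?thesis by (simp add: \<Delta>_def)
qed

lemma h_reflect: "laurent_subst [:0, -1:] h = - h"
proof -
  have "poly_to_laurent r * laurent_subst [:0, -1:] h =
      laurent_subst [:0, -1:] (poly_to_laurent r * h)"
    using r_reflect
    by (simp add: laurent_subst_mult laurent_subst_poly poly_reflect_def)
  also have "\<dots> = (- fls_X_inv) ^ (e - 1)"
    by (simp add: rh laurent_subst_power poly_to_laurent_pCons)
  also have "\<dots> = - (poly_to_laurent r * h)"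
    using e_even e_ge unfolding rh by simp
  finally have "poly_to_laurent r * laurent_subst [:0, -1:] h = poly_to_laurent r * (- h)" by simp
  then show ?thesis using r_nz by (simp del: mult_minus_right)
qed

text \<open>In \<Theta>(t) = \<Theta>(t^2) + h the first summand is even and \<open>h\<close> is
  odd.\<close>

lemma Theta_reflect: "laurent_subst [:0, -1:] \<Theta> = \<Theta> - 2 * h"
proof -
  have "laurent_subst [:0, -1:] \<Theta> =
      laurent_subst [:0, -1:] (laurent_subst (monom 1 2) \<Theta>) + laurent_subst [:0, -1:] h"
    by (subst Theta) (simp add: laurent_subst_add)
  also have "\<dots> = laurent_subst (monom 1 2) \<Theta> - h"
    by (simp add: laurent_subst_subst degree_monom_pos h_reflect)
       (simp add: monom_altdef pcompose_mult pcompose_pCons power2_eq_square)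
  also have "\<dots> = \<Theta> - 2 * h" using Theta by (simp add: algebra_simps)
  finally show ?thesis .
qed

definition err :: "nat \<Rightarrow> 'a poly \<Rightarrow> 'a poly \<Rightarrow> 'a fls" where
  "err v Q R = poly_to_laurent Q * (fls_X_inv ^ v * \<Theta>) - poly_to_laurent R"

text \<open>The p-th power of the error is, up to t -> t^p, the error of the fraction
  \<open>frob R / frob Q\<close>. This fraction is therefore as good as \<open>R / Q\<close>, so the
  two are equal; coprimality and equal degrees do the rest.\<close>

lemma frob_proportional:
  assumes "coprime R Q" "Q \<noteq> 0" "fls_order_ge (int (degree Q) + 1) (err v Q R)"
  obtains c where "c \<noteq> 0" "frob Q = smult c Q"
proof -
  have "laurent_subst (monom 1 p) (err v (frob Q) (frob R)) = err v Q R ^ p"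
    unfolding err_def
    by (simp add: laurent_subst_diff laurent_subst_mult degree_monom_pos laurent_subst_poly
        frob_pcompose laurent_subst_power frob_diff_fls power_mult_distrib Theta_frob
        poly_to_laurent_monom mult.commute flip: power_mult)
  moreover have "fls_order_ge (int p * (int (degree Q) + 1)) (err v Q R ^ p)"
    using assms(3) p_pos unfolding fls_order_ge_def fls_subdegree_pow
    by (auto simp: fls_subdegree_pow)
  ultimately have "fls_order_ge (int (degree Q) + 1) (err v (frob Q) (frob R))"
    using fls_order_ge_subst_iff[OF degree_monom_pos(1), of "int (degree Q) + 1" "err v (frob Q) (frob R)"]
    by (simp add: degree_monom_eq)
  then have "frob Q * R = Q * frob R"
    using assms(3) unfolding err_def by (intro good_fractions_equal) simp_all
  then have "Q dvd R * frob Q" by (metis dvd_triv_left mult.commute)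
  then have "Q dvd frob Q" by (rule coprime_poly_dvd_mult[OF assms(1,2)])
  then obtain k where k: "frob Q = Q * k" by (auto elim: dvdE)
  with assms(2) have k0: "k \<noteq> 0" by (metis frob_eq_0_iff mult_zero_right)
  have "degree (frob Q) = degree Q + degree k" using k k0 assms(2) by (simp add: degree_mult_eq)
  then have "degree k = 0" by simp
  then obtain c where "k = [:c:]" by (auto elim: degree_eq_zeroE)
  with k k0 that[of c] show ?thesis by simp
qed

text \<open>Modulo \<open>r\<close> the power t^e is -1, so t is invertible. The identity below
  exhibits the inverse of t^k, using that (-t^e)^k is congruent to 1.\<close>

lemma r_dvd_monom_mult:
  assumes "r dvd monom 1 k * Q"
  shows "r dvd Q"
proof (rule coprime_poly_dvd_mult[OF _ r_nz assms])
  have "(-1) ^ k * (monom 1 e) ^ k + (1 - (-1) ^ k * monom 1 e ^ k) = (1::'a poly)" by simp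
  moreover have "r dvd 1 - (-1) ^ k * monom 1 e ^ k"
  proof -
    have "1 - (- monom 1 e) dvd (1::'a poly) ^ k - (- monom 1 e) ^ k"
      unfolding power_diff_sumr2 by (rule dvd_triv_left)
    then show ?thesis by (simp add: r_def add.commute power_minus[of "monom 1 e"])
  qed
  then obtain w where "1 - (-1) ^ k * monom 1 e ^ k = r * w" by (auto elim: dvdE)
  moreover have "monom 1 e ^ k = monom 1 k * (monom (1::'a) k ^ (e - 1))"
    using e_ge by (simp add: monom_power mult_monom) (cases e; simp add: algebra_simps)
  ultimately have "((-1) ^ k * monom 1 k ^ (e - 1)) * monom 1 k + w * r = (1::'a poly)"
    by (metis (no_types, lifting) mult.assoc mult.commute)
  then show "coprime (monom 1 k) r" by (rule bezout_imp_coprime)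
qed

text \<open>Modulo \<open>r\<close> one has \<open>t\<^sup>p \<equiv> - t\<close>, so that the Frobenius map interchanges
  \<open>Q(t)\<close> and \<open>Q(-t)\<close> up to constants.\<close>

lemma r_dvd_of_reflect:
  assumes c: "c \<noteq> 0" "frob Q = smult c Q" and "r dvd Q * poly_reflect Q"
  shows "r dvd Q"
proof -
  let ?N = "poly_reflect Q"
  have "monom 1 p - [:0, -1:] = [:0, 1:] * r"
    unfolding r_def p_eq by (simp add: monom_Suc)
  then have "r dvd pcompose (frob Q) (monom 1 p) - pcompose (frob Q) [:0, -1:]"
    using pcompose_diff_dvd[of "monom 1 p" "[:0,-1:]" "frob Q"] by (metis dvd_mult_right)
  then have 1: "r dvd Q ^ p - smult c ?N"
    unfolding frob_pcompose unfolding c(2) pcompose_smult poly_reflect_def .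
  have 2: "r dvd ?N ^ p - smult c Q"
  proof -
    from 1 obtain k where "Q ^ p - smult c ?N = r * k" by (auto elim: dvdE)
    then have "poly_reflect (Q ^ p - smult c ?N) = poly_reflect (r * k)" by simp
    then show ?thesis by simp
  qed
  have *: "r dvd x" if "r dvd smult c x" for x
    using that c(1) by (simp add: dvd_smult_iff)
  \<comment> \<open>As \<open>?N ^ p\<close> is congruent to a nonzero multiple of \<open>Q\<close>,
    \<open>r\<close> divides \<open>Q ^ 2\<close>, hence \<open>Q ^ p\<close>, which in turn is
    congruent to a nonzero multiple of \<open>?N\<close>.\<close>
  have "r dvd Q * ?N ^ p"
    using assms(3) p_pos by (cases p) (simp_all add: mult.assoc[symmetric])
  moreover have "r dvd Q * (?N ^ p - smult c Q)" using 2 by simp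
  ultimately have "r dvd Q * ?N ^ p - Q * (?N ^ p - smult c Q)" by (rule dvd_diff)
  then have "r dvd smult c (Q * Q)" by (simp add: algebra_simps)
  then have "r dvd Q ^ 2" by (simp add: * power2_eq_square)
  moreover have "Q ^ 2 dvd Q ^ p" using e_ge p_eq by (intro le_imp_power_dvd) simp
  ultimately have "r dvd Q ^ p" by (rule dvd_trans)
  with 1 have "r dvd Q ^ p - (Q ^ p - smult c ?N)" by (rule dvd_diff[rotated])
  then have "r dvd ?N" by (simp add: *)
  then obtain k where "?N = r * k" by (auto elim: dvdE)
  then have "poly_reflect ?N = poly_reflect (r * k)" by simp
  then show ?thesis by simp
qed

section \<open>Counting zeros on the prime field\<close>

text \<open>As e = p - 1, this is the multiplicative group of the prime field, encoded as roots of
  unity.\<close>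

definition U :: "'a set" where "U = {x. x ^ e = 1}"

definition misses :: "'a poly \<Rightarrow> nat" where "misses Q = card {x \<in> U. poly Q x \<noteq> 0}"

lemma card_power_eq_le:
  assumes "n > 0"
  shows "card {x::'a. x ^ n = c} \<le> n" "finite {x::'a. x ^ n = c}"
proof -
  let ?P = "monom 1 n + [:- c:] :: 'a poly"
  have "degree ?P = n" using assms by (simp add: degree_add_eq_left degree_monom_eq)
  moreover have "?P \<noteq> 0" using calculation assms by auto
  moreover have "{x::'a. x ^ n = c} = {x. poly ?P x = 0}" by (simp add: poly_monom)
  ultimately show "card {x::'a. x ^ n = c} \<le> n" "finite {x::'a. x ^ n = c}"
    using card_poly_roots_bound[of ?P] poly_roots_finite[of ?P] by simp_all
qed

lemma U_iff: "x \<in> U \<longleftrightarrow> (x ^ d)\<^sup>2 = 1"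
  unfolding U_def by (simp add: e_eq power_even_eq)

lemma finite_U: "finite U"
  unfolding U_def using e_ge by (intro card_power_eq_le) simp

lemma U_nz: "x \<in> U \<Longrightarrow> x \<noteq> 0"
  using e_ge by (auto simp: U_def power_0_left)

lemma U_uminus: "x \<in> U \<Longrightarrow> - x \<in> U"
  using e_even by (simp add: U_def)

text \<open>The upper bound counts roots of a polynomial. For the lower bound, the images of 1, ...,
  p - 1 are distinct, nonzero and fixed by the Frobenius map.\<close>

lemma card_U: "card U = e"
proof (rule antisym)
  show "card U \<le> e" unfolding U_def using e_ge by (intro card_power_eq_le) simp
  have inj: "inj_on (of_nat :: nat \<Rightarrow> 'a) {1..e}"
  proof (rule inj_onI)
    fix i j assume ij: "i \<in> {1..e}" "j \<in> {1..e}" "of_nat i = (of_nat j :: 'a)"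
    have *: "i = j" if "i \<le> j" "i \<in> {1..e}" "j \<in> {1..e}" "of_nat i = (of_nat j :: 'a)" for i j
    proof -
      have "of_nat (j - i) = (0::'a)" using that by (simp add: of_nat_diff)
      then have "p dvd j - i" using of_nat_eq_0_iff_char_dvd[where 'a='a] p(3) by simp
      moreover have "j - i < p" using that p_eq by auto
      ultimately have "j - i = 0" using nat_dvd_not_less[of "j - i" p] by blast
      then show ?thesis using that(1) by simp
    qed
    show "i = j"
    proof (rule linorder_le_cases[of i j])
      assume "i \<le> j"
      then show "i = j" by (rule *[OF _ ij])
    next
      assume "j \<le> i"
      then show "i = j" by (rule *[OF _ ij(2,1) ij(3)[symmetric], symmetric])
    qed
  qed
  have frob_of_nat: "(of_nat n :: 'a) ^ p = of_nat n" for n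
  proof (induction n)
    case (Suc n)
    have "(of_nat (Suc n) :: 'a) ^ p = 1 ^ p + of_nat n ^ p"
      unfolding of_nat_Suc using p by (intro freshmans_dream) auto
    with Suc show ?case by simp
  qed (use p_pos in simp)
  have "of_nat ` {1..e} \<subseteq> U"
  proof safe
    fix n assume n: "n \<in> {1..e}"
    have "(of_nat n :: 'a) \<noteq> 0"
      using n p_eq of_nat_eq_0_iff_char_dvd[where 'a='a, of n] p(3) by (auto dest: dvd_imp_le)
    with frob_of_nat[of n] show "of_nat n \<in> U" by (simp add: U_def p_eq)
  qed
  then have "card ((of_nat :: nat \<Rightarrow> 'a) ` {1..e}) \<le> card U" by (rule card_mono[OF finite_U])
  then show "e \<le> card U" using card_image[OF inj] by simp
qed

lemma misses_le: "misses Q \<le> e"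
  unfolding misses_def using card_mono[OF finite_U, of "{x \<in> U. poly Q x \<noteq> 0}"] card_U by auto

lemma d_pos: "d > 0"
  using e_ge e_eq by simp

lemma power_d_cases: "x \<in> U \<Longrightarrow> x ^ d = 1 \<or> x ^ d = -1"
  using power2_eq_1_iff[of "x ^ d"] by (simp add: U_iff)

lemma uminus_neq: "x \<in> U \<Longrightarrow> - x \<noteq> (x::'a)"
proof
  assume "x \<in> U" "- x = x"
  then have "2 * x = 0" by (metis add.right_inverse mult_2)
  with two_nz U_nz[OF \<open>x \<in> U\<close>] show False by simp
qed

text \<open>Squaring is at most two-to-one on the 2d elements of \<open>U\<close>, so there are at
  least d squares; all of them satisfy x^d = 1, which has at most d solutions.\<close>

lemma squares_U: "(\<lambda>x. x ^ 2) ` U = {x \<in> U. x ^ d = 1}"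
proof (rule card_seteq)
  let ?W = "(\<lambda>x. x ^ 2) ` U"
  have sub: "{x \<in> U. x ^ d = 1} \<subseteq> {x. x ^ d = 1}" by auto
  show "finite {x \<in> U. x ^ d = 1}" using finite_U by simp
  show "?W \<subseteq> {x \<in> U. x ^ d = 1}"
  proof safe
    fix x assume "x \<in> U"
    then show "x\<^sup>2 ^ d = 1" by (simp add: U_iff power_even_eq flip: power_mult)
    then show "x\<^sup>2 \<in> U" by (simp add: U_iff)
  qed
  define s where "s w = (SOME x. x \<in> U \<and> x ^ 2 = w)" for w
  have s: "s w \<in> U \<and> s w ^ 2 = w" if "w \<in> ?W" for w
    unfolding s_def using that by (auto intro: someI2)
  have "U \<subseteq> (\<Union>w\<in>?W. {s w, - s w})"
  proof
    fix x assume x: "x \<in> U"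
    with s[of "x ^ 2"] have "s (x ^ 2) ^ 2 = x ^ 2" by blast
    then have "x = s (x ^ 2) \<or> x = - s (x ^ 2)" by (metis power2_eq_iff)
    with x show "x \<in> (\<Union>w\<in>?W. {s w, - s w})" by blast
  qed
  then have "card U \<le> card (\<Union>w\<in>?W. {s w, - s w})" by (intro card_mono) (auto simp: finite_U)
  also have "\<dots> \<le> (\<Sum>w\<in>?W. card {s w, - s w})" by (rule card_UN_le) (simp add: finite_U)
  also have "\<dots> \<le> (\<Sum>w\<in>?W. 2)" by (rule sum_mono) (simp add: card_insert_if)
  finally have "d \<le> card ?W" unfolding card_U by (simp add: e_eq)
  moreover have "card {x \<in> U. x ^ d = 1} \<le> d"
    using card_mono[OF card_power_eq_le(2)[OF d_pos] sub] card_power_eq_le(1)[OF d_pos, of 1] by linarith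
  ultimately show "card {x \<in> U. x ^ d = 1} \<le> card ?W" by linarith
qed

text \<open>The squares in \<open>U\<close> are controlled by the zeros of \<open>Q\<close>; a nonsquare \<open>\<kappa>\<close> at which \<open>B\<close> does
  not vanish makes \<open>t\<^sup>2 - \<kappa>\<close>, a factor of \<open>r\<close>, divide the cofactor \<open>C\<close>.\<close>

lemma misses_descent:
  assumes C: "C \<noteq> 0" "r dvd C * poly_sq B"
    and Q: "\<And>x. x \<in> U \<Longrightarrow> poly Q x = 0 \<Longrightarrow> poly B (x ^ 2) = 0"
  shows "2 * misses B \<le> misses Q + degree C"
proof -
  let ?A = "{x \<in> U. x ^ d = 1 \<and> poly B x \<noteq> 0}" and ?A' = "{x \<in> U. x ^ d = -1 \<and> poly B x \<noteq> 0}"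
  have "misses B = card (?A \<union> ?A')"
    unfolding misses_def using power_d_cases by (intro arg_cong[of _ _ card]) blast
  also have "\<dots> \<le> card ?A + card ?A'" by (rule card_Un_le)
  finally have 1: "misses B \<le> card ?A + card ?A'" .
  \<comment> \<open>Each \<open>w\<close> in \<open>?A\<close> has two distinct square roots in
    \<open>U\<close>, and \<open>Q\<close> vanishes at neither. The boolean in \<open>?f\<close>
    selects the sign of the root.\<close>
  have 2: "2 * card ?A \<le> misses Q"
  proof -
    define s where "s w = (SOME x. x \<in> U \<and> x ^ 2 = w)" for w
    have s: "s w \<in> U \<and> s w ^ 2 = w" if "w \<in> ?A" for w
    proof -
      have "w \<in> (\<lambda>x. x ^ 2) ` U" unfolding squares_U using that by blast
      then show ?thesis unfolding s_def by (auto intro: someI2)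
    qed
    let ?f = "\<lambda>(w, b). if b then s w else - s w"
    have "card (?A \<times> (UNIV :: bool set)) \<le> card {x \<in> U. poly Q x \<noteq> 0}"
    proof (rule card_inj_on_le[of ?f])
      show "inj_on ?f (?A \<times> UNIV)"
      proof (rule inj_onI)
        fix x y assume xy: "x \<in> ?A \<times> (UNIV :: bool set)" "y \<in> ?A \<times> UNIV" "?f x = ?f y"
        obtain w b w' b' where [simp]: "x = (w, b)" "y = (w', b')" by (cases x; cases y)
        have eq: "(if b then s w else - s w) = (if b' then s w' else - s w')" using xy(3) by simp
        from xy have s': "s w \<in> U" "s w ^ 2 = w" "s w' \<in> U" "s w' ^ 2 = w'" using s by auto
        from eq have "s w ^ 2 = s w' ^ 2" by (metis power2_minus)
        then have "w = w'" using s' by simp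
        with eq uminus_neq[OF s'(1)] show "x = y" by (auto split: if_splits)
      qed
      show "?f ` (?A \<times> UNIV) \<subseteq> {x \<in> U. poly Q x \<noteq> 0}"
      proof (clarify, intro conjI)
        fix w b assume w: "w \<in> U" "w ^ d = 1" "poly B w \<noteq> 0"
        let ?x = "if b then s w else - s w"
        have s': "s w \<in> U" "s w ^ 2 = w" using s w by auto
        then show U: "?x \<in> U" using U_uminus by auto
        have "?x ^ 2 = w" using s' by simp
        then show "poly Q ?x \<noteq> 0" using Q[OF U] w(3) by metis
      qed
    qed (simp add: finite_U)
    then show ?thesis by (simp add: misses_def card_cartesian_product)
  qed
  \<comment> \<open>Since r(t) = \<rho>(t^2), comparing even and odd parts turns the divisibility by
    \<open>r\<close> into one by \<rho> for both \<open>C0 * B\<close> and \<open>C1 * B\<close>.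
    The elements of \<open>?A'\<close> are zeros of \<rho> but not of \<open>B\<close>, hence zeros
    of \<open>C0\<close> and \<open>C1\<close>.\<close>
  have 3: "2 * card ?A' \<le> degree C"
  proof -
    obtain C0 C1 where C01: "C = poly_sq C0 + [:0, 1:] * poly_sq C1" using poly_even_odd_parts .
    obtain k where k: "C * poly_sq B = r * k" using C(2) by (auto elim: dvdE)
    obtain k0 k1 where k01: "k = poly_sq k0 + [:0, 1:] * poly_sq k1" using poly_even_odd_parts .
    let ?\<rho> = "monom 1 d + 1 :: 'a poly"
    have r: "r = poly_sq ?\<rho>" unfolding r_def by (simp add: e_eq poly_sq_monom)
    have "poly_sq (C0 * B) + [:0, 1:] * poly_sq (C1 * B) =
        poly_sq (?\<rho> * k0) + [:0, 1:] * poly_sq (?\<rho> * k1)"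
      using k unfolding C01 k01 r by (simp only: poly_sq_simps algebra_simps)
    then have *: "C0 * B = ?\<rho> * k0" "C1 * B = ?\<rho> * k1" by (rule even_odd_parts_unique)+
    have **: "poly D x = 0" if "D * B = ?\<rho> * k'" "x \<in> ?A'" for D k' x
    proof -
      have "poly D x * poly B x = poly (?\<rho> * k') x" using that(1) by (metis poly_mult)
      also have "\<dots> = 0" using that(2) by (simp add: poly_monom)
      finally show ?thesis using that(2) by simp
    qed
    have ***: "card ?A' \<le> degree D" if "D * B = ?\<rho> * k'" "D \<noteq> 0" for D k'
    proof -
      have "card ?A' \<le> card {x. poly D x = 0}"
        using **[OF that(1)] by (intro card_mono poly_roots_finite that(2)) blast
      also have "\<dots> \<le> degree D" by (rule card_poly_roots_bound[OF that(2)])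
      finally show ?thesis .
    qed
    have "C0 \<noteq> 0 \<or> C1 \<noteq> 0" using C(1) C01 by auto
    then show ?thesis using ***[OF *(1)] ***[OF *(2)] degree_even_odd[OF C01] by linarith
  qed
  from 1 2 3 show ?thesis by linarith
qed

section \<open>The descent\<close>

lemma r_poly_U: "x \<in> U \<Longrightarrow> poly r x \<noteq> 0"
  using two_nz by (simp add: U_def r_def poly_monom)

text \<open>The polynomial of degree at most \<open>e - 1 - 2 * misses Q\<close> below vanishes at all \<open>x\<close> in \<open>U\<close> with
  \<open>Q(x) = Q(-x) = 0\<close>, hence identically.\<close>

lemma r_dvd_denominator:
  assumes "coprime R Q" "Q \<noteq> 0"
    and E: "fls_order_ge (int (degree Q) + 2 * int (misses Q) + 1) (err v Q R)"
  shows "r * ((-1) ^ v * Q * poly_reflect R - poly_reflect Q * R)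
      + 2 * Q * poly_reflect Q * monom 1 (v + (e - 1)) = 0" (is "?D = 0")
    and "r dvd Q"
proof -
  let ?E' = "laurent_subst [:0, -1:] (err v Q R)"
  have E': "?E' = poly_to_laurent (poly_reflect Q) * ((-1) ^ v * fls_X_inv ^ v * (\<Theta> - 2 * h))
      - poly_to_laurent (poly_reflect R)"
  proof -
    have N: "degree [:0, -1::'a:] > 0" by simp
    have "poly_to_laurent [:0, -1::'a:] = - fls_X_inv" by (simp add: poly_to_laurent_pCons)
    then have "laurent_subst [:0, -1::'a:] (fls_X_inv ^ v) = (-1) ^ v * fls_X_inv ^ v"
      by (simp only: laurent_subst_power[OF N] laurent_subst_X_inv[OF N] power_minus[of fls_X_inv v])
    then show ?thesis
      unfolding err_def poly_reflect_def
      by (simp only: laurent_subst_diff[OF N] laurent_subst_mult[OF N] laurent_subst_poly[OF N]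
          Theta_reflect)
  qed
  have s: "(-1) ^ v * (-1) ^ v = (1 :: 'a fls)" by (simp flip: power_mult_distrib)
  have "poly_to_laurent ?D = poly_to_laurent r *
      ((-1) ^ v * poly_to_laurent Q * poly_to_laurent (poly_reflect R)
        - poly_to_laurent (poly_reflect Q) * poly_to_laurent R)
      + 2 * poly_to_laurent Q * poly_to_laurent (poly_reflect Q) * (fls_X_inv ^ v * (poly_to_laurent r * h))"
    unfolding rh
    by (simp only: poly_to_laurent_mult poly_to_laurent_add poly_to_laurent_diff poly_to_laurent_2
        poly_to_laurent_power poly_to_laurent_uminus poly_to_laurent_1 poly_to_laurent_monom
        power_add fls_const_1 mult_1_left)
  also have "\<dots> = poly_to_laurent r *
     (poly_to_laurent (poly_reflect Q) * err v Q R - (-1) ^ v * poly_to_laurent Q * ?E')"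
    unfolding E' unfolding err_def by (rule wronskian_identity[OF s])
  finally have D: "poly_to_laurent ?D = \<dots>" .
  have ordE': "fls_order_ge (int (degree Q) + 2 * int (misses Q) + 1) ?E'"
    using fls_order_ge_subst_iff[of "[:0, -1::'a:]"] E by simp
  have "fls_order_ge (- int e + (2 * int (misses Q) + 1)) (poly_to_laurent ?D)"
    unfolding D
  proof (rule fls_order_ge_mult[OF _ fls_order_ge_diff])
    show "fls_order_ge (- int e) (poly_to_laurent r)"
      using fls_order_ge_poly[of r] by (simp add: degree_r)
    show "fls_order_ge (2 * int (misses Q) + 1) (poly_to_laurent (poly_reflect Q) * err v Q R)"
      using fls_order_ge_mult[OF fls_order_ge_poly[of "poly_reflect Q"] E] by (simp add: algebra_simps)
    have "fls_order_ge 0 ((-1) ^ v :: 'a fls)" by (simp add: fls_order_ge_def fls_subdegree_pow)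
    from fls_order_ge_mult[OF fls_order_ge_mult[OF this fls_order_ge_poly[of Q]] ordE']
    show "fls_order_ge (2 * int (misses Q) + 1) ((-1) ^ v * poly_to_laurent Q * ?E')" by (simp add: algebra_simps)
  qed
  then have deg: "?D = 0 \<or> degree ?D + 2 * misses Q + 1 \<le> e"
    unfolding fls_order_ge_poly_iff by linarith
  show D0: "?D = 0"
  proof (rule ccontr)
    assume nz: "?D \<noteq> 0"
    \<comment> \<open>A point of \<open>U\<close> outside \<open>?Z\<close> lies in
      \<open>?M\<close> or in its negative, so \<open>?Z\<close> has at least
      \<open>e - 2 * misses Q\<close> elements; every term of \<open>?D\<close> contains Q(t) or
      Q(-t) as a factor and vanishes on \<open>?Z\<close>.\<close>
    let ?M = "{x \<in> U. poly Q x \<noteq> 0}" and ?Z = "{x \<in> U. poly Q x = 0 \<and> poly Q (- x) = 0}"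
    have "card U \<le> card (?Z \<union> (?M \<union> uminus ` ?M))"
      using U_uminus by (intro card_mono) (force simp: finite_U image_iff)+
    also have "\<dots> \<le> card ?Z + (card ?M + card (uminus ` ?M))"
      by (meson add_left_mono card_Un_le order_trans)
    also have "card (uminus ` ?M) = card ?M" by (rule card_image) simp
    finally have "e \<le> card ?Z + 2 * misses Q" by (simp add: card_U misses_def)
    moreover have "card ?Z \<le> card {x. poly ?D x = 0}"
      by (intro card_mono poly_roots_finite nz) auto
    moreover have "\<dots> \<le> degree ?D" by (rule card_poly_roots_bound[OF nz])
    ultimately show False using deg nz by linarith
  qed
  have "fls_order_ge (int (degree Q) + 1) (err v Q R)" by (rule fls_order_ge_mono[OF E]) simp
  then obtain c where c: "c \<noteq> 0" "frob Q = smult c Q"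
    by (rule frob_proportional[OF assms(1,2)])
  \<comment> \<open>Now \<open>?D = 0\<close> shows that \<open>r\<close> divides its second term,
    from which the power of t and the constant 2 can be removed.\<close>
  have "r dvd y" if "r * x + y = 0" for x y
  proof -
    from that have "y = r * (- x)" by (simp add: eq_neg_iff_add_eq_0 add.commute)
    then show ?thesis by (rule dvdI)
  qed
  from this[OF D0] have "r dvd monom 1 (v + (e - 1)) * (2 * (Q * poly_reflect Q))"
    by (simp only: ac_simps)
  then have "r dvd 2 * (Q * poly_reflect Q)" by (rule r_dvd_monom_mult)
  then have "r dvd smult 2 (Q * poly_reflect Q)" by (simp add: mult_2 numeral_poly)
  then have "r dvd Q * poly_reflect Q" using two_nz by (simp add: dvd_smult_iff)
  then show "r dvd Q" by (rule r_dvd_of_reflect[OF c])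
qed

text \<open>Subtracting t^m / r from \<open>R / Q\<close> leaves a fraction that is even or odd. In
  lowest terms it is \<open>f / g\<close>, where \<open>f\<close> and \<open>g\<close> are each even
  or odd, so it comes from some \<open>A / B\<close> under t -> t^2, up to powers of t. The
  cancelled factor \<open>C\<close> enters both the error and the count of nonzeros.\<close>

lemma descent:
  assumes RQ: "coprime R Q" "Q \<noteq> 0"
    and E: "fls_order_ge (int (degree Q) + 2 * int (misses Q) + 1) (err v Q R)"
  obtains w A B where "coprime A B" "B \<noteq> 0" "degree B < degree Q"
    "fls_order_ge (int (degree B) + 2 * int (misses B) + 1) (err w B A)"
proof -
  obtain Q' where Q': "Q = r * Q'" using r_dvd_denominator(2)[OF assms] by (auto elim: dvdE)
  define m where "m = v + (e - 1)"
  have Q'0: "Q' \<noteq> 0" using Q' RQ(2) by auto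
  \<comment> \<open>As \<open>Q' = Q / r\<close>, the fraction \<open>S / Q\<close> is
    \<open>R / Q\<close> minus t^m / r.\<close>
  define S where "S = R - Q' * monom 1 m"
  have m_odd: "(-1) ^ m = - ((-1) ^ v :: 'a poly)" "(-1) ^ m = - ((-1) ^ v :: 'a)"
    using e_even e_ge unfolding m_def power_add by simp_all
  have reflS: "poly_reflect S = poly_reflect R + (-1) ^ v * poly_reflect Q' * monom 1 m"
    by (simp add: S_def m_odd) (cases "even v"; simp flip: minus_monom)
  have s: "(-1) ^ v * (-1) ^ v = (1 :: 'a poly)" by (simp flip: power_mult_distrib)
  have "r * ((-1) ^ v * Q * poly_reflect R - poly_reflect Q * R)
      + 2 * Q * poly_reflect Q * monom 1 m = 0"
    using r_dvd_denominator(1)[OF assms] by (simp add: m_def)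
  then have "r * ((-1) ^ v * Q * poly_reflect R - poly_reflect Q * R
      + 2 * r * Q' * poly_reflect Q' * monom 1 m) = 0"
    unfolding Q' by (simp add: algebra_simps)
  then have "(-1) ^ v * Q * poly_reflect R - poly_reflect Q * R
      + 2 * r * Q' * poly_reflect Q' * monom 1 m = 0"
    using r_nz by simp
  moreover have "(-1) ^ v * Q * poly_reflect S - poly_reflect Q * S =
      (-1) ^ v * Q * poly_reflect R - poly_reflect Q * R
        + ((-1) ^ v * (-1) ^ v + 1) * r * Q' * poly_reflect Q' * monom 1 m"
    unfolding reflS unfolding S_def Q' by (simp add: algebra_simps)
  \<comment> \<open>That is, the fraction \<open>S / Q\<close> is multiplied by (-1)^v under t ->
    -t.\<close>
  ultimately have main: "(-1) ^ v * Q * poly_reflect S = poly_reflect Q * S"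
    unfolding s by simp
  obtain C f g u u' where fg: "S = C * f" "Q = C * g" "u * f + u' * g = 1"
    using bezout_poly_reduce[OF RQ(2)] by metis
  have nz: "C \<noteq> 0" "g \<noteq> 0" using fg(2) RQ(2) by auto
  have cop: "coprime f g" by (rule bezout_imp_coprime[OF fg(3)])
  have "(C * poly_reflect C) * ((-1) ^ v * g * poly_reflect f) =
      (C * poly_reflect C) * (poly_reflect g * f)"
    using main unfolding fg(1,2) by (simp add: algebra_simps)
  moreover have "poly_reflect C \<noteq> 0" using nz(1) by (metis poly_reflect_reflect poly_reflect_simps(1))
  ultimately have gf: "(-1) ^ v * g * poly_reflect f = poly_reflect g * f"
    using nz(1) by (simp only: mult_cancel_left) simp
  \<comment> \<open>By coprimality \<open>g\<close> is proportional to its reflection; comparing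
    leading coefficients below identifies the factor as (-1)^n.\<close>
  have "g dvd f * poly_reflect g"
    by (rule dvdI[of _ _ "(-1) ^ v * poly_reflect f"]) (use gf in \<open>simp add: algebra_simps\<close>)
  then have "g dvd poly_reflect g" by (rule coprime_poly_dvd_mult[OF cop nz(2)])
  then obtain k where k: "poly_reflect g = g * k" by (auto elim: dvdE)
  have k0: "k \<noteq> 0" using k nz(2) by (metis mult_zero_right poly_reflect_reflect poly_reflect_simps(1))
  have "degree (poly_reflect g) = degree g + degree k"
    unfolding k by (rule degree_mult_eq[OF nz(2) k0])
  then have "degree k = 0" by simp
  then obtain c where c: "k = [:c:]" by (auto elim: degree_eq_zeroE)
  define n where "n = degree g"
  have "coeff (poly_reflect g) n = (-1) ^ n * coeff g n" by (rule coeff_poly_reflect)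
  then have "c * coeff g n = (-1) ^ n * coeff g n" unfolding k c by (simp add: mult.commute)
  moreover have "coeff g n \<noteq> 0" using nz(2) by (simp add: n_def)
  ultimately have c: "c = (-1) ^ n" by simp
  then have reflg: "poly_reflect g = smult ((-1) ^ n) g" using k \<open>k = [:c:]\<close> by simp
  have reflf: "poly_reflect f = smult ((-1) ^ (n + v)) f"
  proof -
    have "g * ((-1) ^ v * poly_reflect f) = g * smult ((-1) ^ n) f"
      using gf unfolding reflg by (simp add: algebra_simps)
    then have "(-1) ^ v * poly_reflect f = smult ((-1) ^ n) f"
      using nz(2) by (simp only: mult_cancel_left) simp
    then have "(-1) ^ v * ((-1) ^ v * poly_reflect f) = (-1) ^ v * smult ((-1) ^ n) f" by simp
    then have "poly_reflect f = (-1) ^ v * smult ((-1) ^ n) f" unfolding mult.assoc[symmetric] s by simp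
    then show ?thesis by (cases "even v"; cases "even n"; simp)
  qed
  obtain B where B: "g = (if even n then poly_sq B else [:0, 1:] * poly_sq B)"
    by (rule poly_parity_cases[OF reflg two_nz])
  obtain A where A: "f = (if even (n + v) then poly_sq A else [:0, 1:] * poly_sq A)"
    by (rule poly_parity_cases[OF reflf two_nz])
  have B0: "B \<noteq> 0" using B nz(2) by (auto split: if_splits)
  have sq_dvd: "poly_sq D dvd poly_sq X" if "D dvd X" for D X :: "'a poly"
    using that by (auto elim!: dvdE)
  have copAB: "coprime A B"
  proof (rule coprimeI)
    fix D assume "D dvd A" "D dvd B"
    then have "poly_sq D dvd f" "poly_sq D dvd g"
      unfolding A B using sq_dvd by (auto simp del: mult_pCons_left intro: dvd_mult)
    then have "is_unit (poly_sq D)" using cop by (auto simp: coprime_def)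
    moreover have "D \<noteq> 0" using \<open>D dvd B\<close> B0 by auto
    moreover then have "poly_sq D \<noteq> 0" by (simp add: poly_sq_def pcompose_eq_0_iff degree_monom_eq)
    ultimately show "is_unit D" by (simp add: is_unit_iff_degree)
  qed
  have degQ: "degree Q = degree C + n" unfolding fg(2) n_def using nz by (simp add: degree_mult_eq)
  have n: "n = 2 * degree B + (if even n then 0 else 1)"
    by (subst n_def, subst B)
       (use B0 in \<open>auto simp: poly_sq_def degree_pcompose degree_monom_eq pcompose_eq_0_iff\<close>)
  have mis: "2 * misses B \<le> misses Q + degree C"
  proof (rule misses_descent[OF nz(1)])
    have "r dvd C * g" using Q' fg(2) by (metis dvd_triv_left)
    show "r dvd C * poly_sq B"
    proof (cases "even n")
      case False
      with \<open>r dvd C * g\<close> have "r dvd monom 1 1 * (C * poly_sq B)"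
        unfolding B by (simp add: monom_Suc monom_0)
      then show ?thesis by (rule r_dvd_monom_mult)
    qed (use \<open>r dvd C * g\<close> B in simp)
  next
    fix x assume x: "x \<in> U" "poly Q x = 0"
    \<comment> \<open>\<open>r\<close> has no zero in \<open>U\<close>, so a zero of
      \<open>C\<close> in \<open>U\<close> would be one of \<open>Q'\<close> and of
      \<open>S\<close>, hence a common zero of \<open>R\<close> and \<open>Q\<close>.\<close>
    have "poly C x \<noteq> 0"
    proof
      assume "poly C x = 0"
      with x Q' r_poly_U[OF x(1)] have "poly Q' x = 0" by simp
      moreover have "poly S x = 0" using \<open>poly C x = 0\<close> fg(1) by simp
      ultimately have "poly R x = 0" by (simp add: S_def)
      with coprime_poly_roots[OF RQ(1)] x(2) show False by blast
    qed
    with x(2) fg(2) have "poly g x = 0" by simp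
    then show "poly B (x ^ 2) = 0" using U_nz[OF x(1)] by (simp add: B split: if_splits)
  qed
  let ?sub = "laurent_subst (monom 1 2 :: 'a poly)"
  have deg2: "degree (monom 1 2 :: 'a poly) > 0" by (simp add: degree_monom_eq)
  have sub_poly: "?sub (poly_to_laurent X) = poly_to_laurent (poly_sq X)" for X
    by (simp add: laurent_subst_poly[OF deg2] poly_sq_def)
  have sub_t: "?sub (fls_X_inv ^ k) = fls_X_inv ^ (2 * k)" for k
    by (simp add: laurent_subst_power[OF deg2] laurent_subst_X_inv[OF deg2] poly_to_laurent_monom
        flip: power_mult)
  have sub_err: "?sub (err w X Y) =
      poly_to_laurent (poly_sq X) * (fls_X_inv ^ (2 * w) * ?sub \<Theta>) - poly_to_laurent (poly_sq Y)"
    for w X Y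
    unfolding err_def by (simp only: laurent_subst_diff[OF deg2] laurent_subst_mult[OF deg2] sub_poly sub_t)
  define I where "I = poly_to_laurent g * (fls_X_inv ^ v * ?sub \<Theta>) - poly_to_laurent f"
  have err_I: "err v Q R = poly_to_laurent C * I"
  proof -
    have "err v Q R = poly_to_laurent Q * (fls_X_inv ^ v * ?sub \<Theta>)
        + poly_to_laurent Q' * (fls_X_inv ^ v * (poly_to_laurent r * h)) - poly_to_laurent R"
      unfolding err_def by (subst Theta) (simp add: Q' algebra_simps)
    also have "\<dots> = poly_to_laurent Q * (fls_X_inv ^ v * ?sub \<Theta>) - poly_to_laurent S"
      unfolding rh S_def m_def by (simp add: poly_to_laurent_monom power_add)
    also have "\<dots> = poly_to_laurent C * I" unfolding fg(1,2) I_def by (simp add: algebra_simps)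
    finally show ?thesis .
  qed
  \<comment> \<open>The powers of t from t^v and from odd \<open>f\<close> or \<open>g\<close>
    combine into t^(2w), with one factor t left over if \<open>n\<close> is even and
    \<open>v\<close> odd. Odd \<open>n\<close> with even \<open>v\<close> would make both
    \<open>f\<close> and \<open>g\<close> divisible by t.\<close>
  have "\<exists>w \<delta>. \<delta> \<le> (1::nat) \<and> I = fls_X_inv ^ \<delta> * ?sub (err w B A)"
  proof (cases "even n"; cases "even v")
    assume "even n" "even v"
    then have "I = fls_X_inv ^ 0 * ?sub (err (v div 2) B A)"
      unfolding sub_err I_def A B by simp
    then show ?thesis by blast
  next
    assume "even n" "odd v"
    then obtain k where v: "v = Suc (2 * k)" by (auto elim: oddE)
    have "I = fls_X_inv ^ 1 * ?sub (err k B A)"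
      unfolding sub_err I_def A B v using \<open>even n\<close>
      by (simp add: poly_to_laurent_pCons algebra_simps)
    then show ?thesis by blast
  next
    assume "odd n" "odd v"
    then obtain k where v: "v = Suc (2 * k)" by (auto elim: oddE)
    have "I = fls_X_inv ^ 0 * ?sub (err (Suc k) B A)"
      unfolding sub_err I_def A B v using \<open>odd n\<close>
      by (simp add: poly_to_laurent_pCons algebra_simps)
    then show ?thesis by blast
  next
    assume "odd n" "even v"
    then have "poly f 0 = 0" "poly g 0 = 0" by (simp_all add: A B)
    then show ?thesis using coprime_poly_roots[OF cop] by blast
  qed
  then obtain w \<delta> where I: "I = fls_X_inv ^ \<delta> * ?sub (err w B A)" by blast
  have "fls_order_ge (int (degree B) + 2 * int (misses B) + 1) (err w B A)"
  proof (cases "err w B A = 0")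
    case False
    then have nz': "?sub (err w B A) \<noteq> 0" by (simp add: laurent_subst_eq_0_iff[OF deg2])
    then have "err v Q R \<noteq> 0" using nz(1) by (simp add: err_I I)
    moreover have "fls_subdegree (err v Q R) =
        - int (degree C) - int \<delta> + 2 * fls_subdegree (err w B A)"
      unfolding err_I I using nz(1) nz' fls_subdegree_laurent_subst[OF deg2, of "err w B A"]
      by (simp add: fls_subdegree_pow degree_monom_eq)
    ultimately have "int (degree Q) + 2 * int (misses Q) + 1 \<le>
        - int (degree C) - int \<delta> + 2 * fls_subdegree (err w B A)"
      using E by (simp add: fls_order_ge_def)
    \<comment> \<open>Twice the right side is at least
      \<open>2 * degree B + 4 * misses B + 1\<close>; integrality supplies the missing half after
      division by 2.\<close>
    then have "int (degree B) + 2 * int (misses B) + 1 \<le> fls_subdegree (err w B A)"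
      using degQ n mis by linarith
    then show ?thesis by (simp add: fls_order_ge_def)
  qed (simp add: fls_order_ge_def)
  moreover have "degree B < degree Q"
  proof -
    have "degree Q = e + degree Q'" using Q' Q'0 r_nz degree_r by (simp add: degree_mult_eq)
    then show ?thesis using degQ n e_ge by linarith
  qed
  ultimately show ?thesis using that[OF copAB B0] by blast
qed

text \<open>Infinite descent on the degree of the denominator; \<open>v\<close> is generalized
  because the descent changes the shift.\<close>

lemma no_good_coprime_fraction:
  assumes "coprime R Q" "Q \<noteq> 0"
  shows "\<not> fls_order_ge (int (degree Q) + 2 * int (misses Q) + 1) (err v Q R)"
  using assms
proof (induction "degree Q" arbitrary: Q R v rule: less_induct)
  case less
  show ?case using descent[OF less.prems] less.hyps by metis
qed

text \<open>Cancelling a common factor only improves the approximation, and \<open>misses_le\<close>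
  makes the bound uniform.\<close>

lemma no_good_fraction:
  assumes "Q \<noteq> 0"
  shows "\<not> fls_order_ge (int (degree Q) + 2 * int e + 1) (err v Q R)"
proof
  assume E: "fls_order_ge (int (degree Q) + 2 * int e + 1) (err v Q R)"
  obtain H f g u u' where fg: "R = H * f" "Q = H * g" "u * f + u' * g = 1"
    using bezout_poly_reduce[OF assms] by metis
  have nz: "H \<noteq> 0" "g \<noteq> 0" using assms fg(2) by auto
  have "err v Q R = poly_to_laurent H * err v g f"
    unfolding err_def fg(1,2) by (simp add: algebra_simps)
  then have "fls_order_ge (int (degree g) + 2 * int (misses g) + 1) (err v g f)"
    using E nz misses_le[of g] unfolding fls_order_ge_def fg(2)
    by (cases "err v g f = 0") (auto simp: degree_mult_eq)
  with no_good_coprime_fraction[OF bezout_imp_coprime[OF fg(3)] nz(2)] show False by blast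
qed

end

section \<open>Series of bounded deficiency\<close>

text \<open>In terms of continued fractions: no t^v \<Theta> is rational and all partial quotients
  after the polynomial part have degree less than \<open>c\<close>.\<close>

definition bounded_deficiency :: "nat \<Rightarrow> 'a::field fls \<Rightarrow> bool" where
  "bounded_deficiency c \<Theta> \<longleftrightarrow> (\<forall>v Q R. Q \<noteq> 0 \<longrightarrow>
     \<not> fls_order_ge (int (degree Q) + int c) (poly_to_laurent Q * (fls_X_inv ^ v * \<Theta>) - poly_to_laurent R))"

lemma laurent_frac_nth: "fls_nth (laurent_frac f) n = (if n \<ge> 1 then fls_nth f n else 0)"
  by (simp add: laurent_frac.rep_eq)

lemma laurent_frac_order: "fls_order_ge 1 (laurent_frac f)"
  by (simp add: fls_order_ge_iff_nth laurent_frac_nth)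

lemma minus_laurent_frac_poly: "\<exists>R. f - laurent_frac f = poly_to_laurent R"
proof -
  define R where "R = Abs_poly (\<lambda>i. fls_nth f (- int i))"
  have "coeff R = (\<lambda>i. fls_nth f (- int i))"
    unfolding R_def
  proof (rule Abs_poly_inverse, rule CollectI)
    have "fls_nth f (- int i) = 0" if "nat (- fls_subdegree f) < i" for i
      using that by (intro fls_eq0_below_subdegree) linarith
    then show "\<forall>\<^sub>\<infinity>i. fls_nth f (- int i) = 0"
      unfolding MOST_nat by blast
  qed
  then have "f - laurent_frac f = poly_to_laurent R"
    by (intro fls_eqI) (simp add: laurent_frac_nth poly_to_laurent_nth)
  then show ?thesis by blast
qed

lemma laurent_frac_eqI:
  assumes "fls_order_ge 1 z"
  shows "laurent_frac (poly_to_laurent R + z) = z"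
  by (rule fls_eqI) (use assms in \<open>auto simp: laurent_frac_nth poly_to_laurent_nth fls_order_ge_iff_nth\<close>)

text \<open>Expansion in base \<open>P\<close>, with the digits regrouped by powers of t; it comes
  from repeated division with remainder.\<close>

lemma base_poly_expansion:
  fixes P M :: "'a::field poly"
  assumes P: "degree P > 0"
  shows "\<exists>m. M = (\<Sum>j<degree P. monom 1 j * pcompose (m j) P)"
proof (induction "degree M" arbitrary: M rule: less_induct)
  case less
  let ?k = "degree P"
  have P0: "P \<noteq> 0" using P by auto
  define q where "q = M div P"
  define s where "s = M mod P"
  have M: "M = q * P + s" by (simp add: q_def s_def)
  have s: "degree s < ?k" using degree_mod_less[OF P0, of M] P by (auto simp: s_def)
  have s_sum: "s = (\<Sum>j<?k. monom 1 j * [:coeff s j:])"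
    by (rule poly_eqI) (use s in \<open>auto simp: coeff_sum coeff_monom_mult coeff_eq_0
        pCons_0_0 coeff_pCons mult.commute[of "monom _ _"] sum.delta
        smult_monom split: nat.splits\<close>)
  have "\<exists>m. q = (\<Sum>j<?k. monom 1 j * pcompose (m j) P)"
  proof (cases "q = 0")
    case True
    then show ?thesis by (intro exI[of _ "\<lambda>_. 0"]) simp
  next
    case False
    have "degree (q * P) = degree q + ?k" using False P0 by (simp add: degree_mult_eq)
    then have "degree M = degree q + ?k" unfolding M using s by (simp add: degree_add_eq_left)
    then show ?thesis using less P by simp
  qed
  then obtain m where m: "q = (\<Sum>j<?k. monom 1 j * pcompose (m j) P)" by blast
  have "M = (\<Sum>j<?k. monom 1 j * pcompose (pCons (coeff s j) (m j)) P)"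
    unfolding M by (subst s_sum, subst m)
      (simp add: pcompose_pCons sum_distrib_left sum_distrib_right algebra_simps sum.distrib)
  then show ?case by (rule exI[of _ "\<lambda>j. pCons (coeff s j) (m j)"])
qed

text \<open>The terms of the sum below have pairwise incongruent orders modulo the degree of \<open>P\<close>, so that
  nothing cancels.\<close>

lemma subst_sum_order:
  fixes P :: "'a::field poly"
  assumes P: "degree P > 0" and i: "i < degree P" "f i \<noteq> 0"
  defines "s \<equiv> (\<Sum>j<degree P. fls_X_inv ^ j * laurent_subst P (f j))"
  shows "s \<noteq> 0" "fls_subdegree s \<le> int (degree P) * fls_subdegree (f i) - int i"
proof -
  let ?k = "degree P" and ?g = "\<lambda>j. fls_X_inv ^ j * laurent_subst P (f j)"
  let ?o = "\<lambda>j. int ?k * fls_subdegree (f j) - int j"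
  have sub: "fls_subdegree (?g j) = ?o j" "?g j \<noteq> 0" if "f j \<noteq> 0" for j
    using that fls_subdegree_laurent_subst[OF P, of "f j"] laurent_subst_eq_0_iff[OF P, of "f j"]
    by (simp_all add: fls_subdegree_pow)
  let ?J = "{j. j < ?k \<and> f j \<noteq> 0}"
  have J: "finite (?o ` ?J)" "?o ` ?J \<noteq> {}" using i by auto
  \<comment> \<open>The order of the sum is attained at the term \<open>j0\<close> of least order;
    all other terms have strictly larger order.\<close>
  then obtain j0 where j0': "j0 \<in> ?J" "?o j0 = Min (?o ` ?J)" using Min_in[OF J] by fastforce
  then have j0: "j0 \<in> ?J" "\<And>j. j \<in> ?J \<Longrightarrow> ?o j0 \<le> ?o j" using Min_le[OF J(1)] by auto
  have "fls_nth (?g j) (?o j0) = 0" if "j < ?k" "j \<noteq> j0" for j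
  proof (cases "f j = 0")
    case True
    then show ?thesis using P by simp
  next
    case False
    have "?o j0 \<noteq> ?o j"
    proof
      assume "?o j0 = ?o j"
      then have "int j0 - int j = int ?k * (fls_subdegree (f j0) - fls_subdegree (f j))"
        by (simp add: algebra_simps)
      then have "int ?k dvd int j0 - int j" by simp
      then have "int j0 mod int ?k = int j mod int ?k" by (simp add: mod_eq_dvd_iff)
      then show False using that j0(1) by simp
    qed
    with j0(2)[of j] that False have "?o j0 < fls_subdegree (?g j)" using sub[of j] by simp
    then show ?thesis by (rule fls_eq0_below_subdegree)
  qed
  then have "fls_nth s (?o j0) = fls_nth (?g j0) (?o j0)"
    unfolding s_def fls_nth_sum using j0(1) by (subst sum.remove[of _ j0]) auto
  also have "\<dots> \<noteq> 0" using sub[of j0] j0(1) nth_fls_subdegree_zero_iff[of "?g j0"] by simp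
  finally have nz: "fls_nth s (?o j0) \<noteq> 0" .
  then show "s \<noteq> 0" by auto
  from nz have "fls_subdegree s \<le> ?o j0" by (rule fls_subdegree_leI)
  also have "\<dots> \<le> ?o i" using j0(2) i by blast
  finally show "fls_subdegree s \<le> ?o i" .
qed

lemma norm_base_gt_1: "norm_base TYPE('a::field) > 1"
proof (cases "finite (UNIV :: 'a set)")
  case True
  have "card {0, 1 :: 'a} \<le> card (UNIV :: 'a set)" using True by (intro card_mono) auto
  then show ?thesis using True by (simp add: norm_base_def)
qed (simp add: norm_base_def)

text \<open>Write N = P^v M. The factor P^v cancels in |N| |N|_P, and in the product with
  \<Theta>(P) it becomes the shift t^v \<Theta>. Expanding \<open>M\<close> in base \<open>P\<close>
  reduces the fractional part to those of the series \<open>\<alpha> j\<close>, to one of which the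
  bounded deficiency applies.\<close>

lemma littlewood_inf_pos:
  fixes P :: "'a::field poly"
  assumes irr: "irreducible P" and bd: "bounded_deficiency c \<Theta>"
  shows "littlewood_inf P (laurent_subst P \<Theta>) > 0"
proof -
  let ?q = "real (norm_base TYPE('a))" and ?k = "degree P"
  have q: "?q > 1" using norm_base_gt_1[where 'a='a] by simp
  have P0: "P \<noteq> 0" using irr by auto
  have "\<not> P dvd 1" using irr by (auto simp: irreducible_def)
  then have k: "?k > 0" using P0 by (simp add: is_unit_iff_degree)
  have "?q powi (- int (?k * c)) \<le> laurent_abs (poly_to_laurent N) *
      laurent_abs (laurent_frac (poly_to_laurent N * laurent_subst P \<Theta>)) * adic_norm P N"
    if N: "N \<noteq> 0" for N
  proof -
    define v where "v = adic_valuation P N"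
    have "v \<in> {j. P ^ j dvd N}"
      unfolding v_def adic_valuation_def
      by (rule Max_in[OF finite_adic_exponents[OF irr N]]) (auto intro!: exI[of _ 0])
    then obtain M where M: "N = P ^ v * M" by (auto elim: dvdE)
    have M0: "M \<noteq> 0" using N M by auto
    obtain m where m: "M = (\<Sum>j<?k. monom 1 j * pcompose (m j) P)"
      using base_poly_expansion[OF k] by blast
    obtain i where i: "i < ?k" "m i \<noteq> 0"
      using M0 unfolding m by (metis (no_types, lifting) lessThan_iff mult_zero_right pcompose_0 sum.neutral)
    define \<alpha> where "\<alpha> j = poly_to_laurent (m j) * (fls_X_inv ^ v * \<Theta>)" for j
    define z where "z = (\<Sum>j<?k. fls_X_inv ^ j * laurent_subst P (laurent_frac (\<alpha> j)))"
    have "\<forall>j. \<exists>R. \<alpha> j - laurent_frac (\<alpha> j) = poly_to_laurent R"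
      using minus_laurent_frac_poly by blast
    then obtain R where R: "\<And>j. \<alpha> j - laurent_frac (\<alpha> j) = poly_to_laurent (R j)"
      by metis
    have M_eq: "poly_to_laurent M = (\<Sum>j<?k. fls_X_inv ^ j * laurent_subst P (poly_to_laurent (m j)))"
      unfolding m by (simp add: poly_to_laurent_monom laurent_subst_poly[OF k])
    have "poly_to_laurent N * laurent_subst P \<Theta> = (\<Sum>j<?k. fls_X_inv ^ j * laurent_subst P (\<alpha> j))"
      unfolding M \<alpha>_def
      by (simp add: M_eq laurent_subst_mult[OF k] laurent_subst_power[OF k] laurent_subst_X_inv[OF k]
          sum_distrib_left sum_distrib_right algebra_simps)
    also have "\<dots> = (\<Sum>j<?k. fls_X_inv ^ j * laurent_subst P (poly_to_laurent (R j) + laurent_frac (\<alpha> j)))"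
      by (simp flip: R)
    also have "\<dots> = poly_to_laurent (\<Sum>j<?k. monom 1 j * pcompose (R j) P) + z"
      unfolding z_def
      by (simp add: laurent_subst_add[OF k] laurent_subst_poly[OF k] distrib_left sum.distrib
          poly_to_laurent_monom)
    finally have eq: "poly_to_laurent N * laurent_subst P \<Theta> =
        poly_to_laurent (\<Sum>j<?k. monom 1 j * pcompose (R j) P) + z" .
    \<comment> \<open>The factor t^j costs less than the order gained by the substitution, since j
      is less than the degree of \<open>P\<close>.\<close>
    have "fls_order_ge 1 z"
      unfolding z_def fls_order_ge_iff_nth fls_nth_sum
    proof (intro allI impI sum.neutral ballI)
      fix n :: int and j assume n: "n < 1" and j: "j \<in> {..<?k}"
      let ?f = "laurent_subst P (laurent_frac (\<alpha> j))"
      have "fls_order_ge (int ?k * 1) ?f"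
        unfolding fls_order_ge_subst_iff[OF k] by (rule laurent_frac_order)
      moreover have "fls_order_ge (- int j) (fls_X_inv ^ j :: 'a fls)"
        by (simp add: fls_order_ge_def fls_subdegree_pow)
      ultimately have "fls_order_ge (- int j + int ?k * 1) (fls_X_inv ^ j * ?f)"
        by (intro fls_order_ge_mult)
      then show "fls_nth (fls_X_inv ^ j * ?f) n = 0"
        using n j unfolding fls_order_ge_iff_nth by auto
    qed
    then have frac: "laurent_frac (poly_to_laurent N * laurent_subst P \<Theta>) = z"
      unfolding eq by (rule laurent_frac_eqI)
    have "\<not> fls_order_ge (int (degree (m i)) + int c) (laurent_frac (\<alpha> i))"
    proof -
      have "laurent_frac (\<alpha> i) = poly_to_laurent (m i) * (fls_X_inv ^ v * \<Theta>) - poly_to_laurent (R i)"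
        using R[of i] by (simp add: \<alpha>_def algebra_simps)
      then show ?thesis using bd i(2) unfolding bounded_deficiency_def by simp
    qed
    then have fi: "laurent_frac (\<alpha> i) \<noteq> 0"
      "fls_subdegree (laurent_frac (\<alpha> i)) \<le> int (degree (m i)) + int c"
      by (auto simp: fls_order_ge_def)
    have z: "z \<noteq> 0" "fls_subdegree z \<le> int ?k * fls_subdegree (laurent_frac (\<alpha> i)) - int i"
      unfolding z_def
      using subst_sum_order[of P i "\<lambda>j. laurent_frac (\<alpha> j)", OF k i(1) fi(1)] by auto
    have "- int (degree M) \<le> int ?k * (- int (degree (m i))) - int i"
      using subst_sum_order(2)[of P i "\<lambda>j. poly_to_laurent (m j)", OF k i(1)] i(2)
      unfolding M_eq[symmetric] by simp
    moreover have "int ?k * fls_subdegree (laurent_frac (\<alpha> i)) \<le> int ?k * (int (degree (m i)) + int c)"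
      using fi(2) by (intro mult_left_mono) auto
    \<comment> \<open>The multiples of \<open>degree (m i)\<close> cancel, which leaves
      \<open>2 * int i - int (?k * c)\<close> as a lower bound.\<close>
    ultimately have main: "- int (?k * c) \<le> int (degree M) - fls_subdegree z"
      using z(2) by (simp add: algebra_simps)
    have degN: "degree N = v * ?k + degree M"
      unfolding M using P0 M0 by (simp add: degree_mult_eq degree_power_eq)
    have "?q powi (- int (?k * c)) \<le> ?q powi (int (degree M) - fls_subdegree z)"
      using q main by (intro power_int_increasing) auto
    also have "\<dots> = ?q powi int (degree N) * ?q powi (- fls_subdegree z) * ?q powi (int ?k * (- int v))"
      using q by (simp add: degN flip: power_int_add)
    also have "?q powi (int ?k * (- int v)) = adic_norm P N"
      using N P0 unfolding adic_norm_def v_def[symmetric] laurent_abs_def laurent_deg_poly_to_laurent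
      by (simp only: power_int_mult poly_to_laurent_eq_0_iff if_False)
    also have "?q powi int (degree N) = laurent_abs (poly_to_laurent N)"
      using N unfolding laurent_abs_def laurent_deg_poly_to_laurent by simp
    also have "?q powi (- fls_subdegree z) =
        laurent_abs (laurent_frac (poly_to_laurent N * laurent_subst P \<Theta>))"
      unfolding frac using z(1) by (simp add: laurent_abs_def laurent_deg_def)
    finally show ?thesis .
  qed
  then have "?q powi (- int (?k * c)) \<le> littlewood_inf P (laurent_subst P \<Theta>)"
    unfolding littlewood_inf_def by (intro cINF_greatest) (auto intro!: exI[of _ 1])
  moreover have "?q powi (- int (?k * c)) > 0" using q by simp
  ultimately show ?thesis by linarith
qed

section \<open>Existence of the series in odd characteristic\<close>

lemma inverse_poly_to_laurent_monom_regpart: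
  "fls_regpart (inverse (poly_to_laurent (monom 1 n))) = (fps_X ^ n :: 'a::field fps)"
proof -
  have "inverse (poly_to_laurent (monom 1 n)) = (fps_to_fls (fps_X ^ n) :: 'a fls)"
    by (simp add: poly_to_laurent_monom fps_to_fls_power fls_inverse_X_inv flip: power_inverse)
  then show ?thesis by simp
qed

text \<open>The recursion comes from comparing coefficients in \<Theta>(t) = \<Theta>(t^2) + h. The
  equation leaves the constant coefficient free; the value 0 gives positive order.\<close>

function fold_coeff :: "'a::field fps \<Rightarrow> nat \<Rightarrow> 'a" where
  "fold_coeff H n =
     (if n = 0 then 0 else fps_nth H n + (if even n then fold_coeff H (n div 2) else 0))"
  by pat_completeness auto
termination by (relation "measure snd") auto

declare fold_coeff.simps [simp del]

lemma fold_coeff_0 [simp]: "fold_coeff H 0 = 0"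
  by (simp add: fold_coeff.simps)

lemma fold_equation_solution:
  fixes h :: "'a::field fls"
  assumes "fls_order_ge 1 h"
  shows "\<exists>\<Theta>. \<Theta> = laurent_subst (monom 1 2) \<Theta> + h \<and> fls_order_ge 1 \<Theta>"
proof -
  define H where "H = fls_regpart h"
  have hH: "h = fps_to_fls H"
    using assms unfolding H_def fls_order_ge_def by (auto simp: fls_regpart_to_fls_trivial)
  have H0: "fps_nth H 0 = 0"
    using assms by (simp add: H_def fls_order_ge_iff_nth)
  define T where "T = Abs_fps (fold_coeff H)"
  have "T = fps_compose T (fps_X ^ 2) + H"
  proof (rule fps_ext)
    fix n show "fps_nth T n = fps_nth (fps_compose T (fps_X ^ 2) + H) n"
      unfolding T_def by (simp add: fps_nth_compose_X_power fold_coeff.simps[of H n] H0)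
  qed
  moreover have "fps_X ^ 2 \<noteq> (0 :: 'a fps)" "fps_nth (fps_X ^ 2 :: 'a fps) 0 = 0" by simp_all
  then have "laurent_subst (monom 1 2) (fps_to_fls T) = fps_to_fls (fps_compose T (fps_X ^ 2))"
    unfolding laurent_subst_def inverse_poly_to_laurent_monom_regpart by (rule fls_compose_fps_to_fls)
  ultimately have "fps_to_fls T = laurent_subst (monom 1 2) (fps_to_fls T) + h"
    unfolding hH by (metis fps_to_fls_plus)
  moreover have "fls_order_ge 1 (fps_to_fls T)"
    by (auto simp: fls_order_ge_iff_nth T_def)
  ultimately show ?thesis by blast
qed

lemma odd_char_bounded_deficiency:
  assumes "prime CHAR('a::field)" "odd CHAR('a)"
  shows "\<exists>c (\<Theta> :: 'a fls). bounded_deficiency c \<Theta>"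
proof -
  define p where "p = CHAR('a)"
  define d where "d = (p - 1) div 2"
  define e where "e = p - 1"
  have p: "p \<ge> 2" using prime_ge_2_nat[OF assms(1)] by (simp add: p_def)
  have e: "p = Suc e" "e = 2 * d"
    using p assms(2) by (auto simp: e_def d_def p_def)
  have e0: "e \<ge> 1" using p by (simp add: e_def)
  let ?r = "monom 1 e + 1 :: 'a poly"
  have deg: "degree ?r = e" using e0 by (simp add: degree_add_eq_left degree_monom_eq)
  then have r0: "?r \<noteq> 0" using e0 by auto
  define h :: "'a fls" where "h = poly_to_laurent (monom 1 (e - 1)) / poly_to_laurent ?r"
  have rh: "poly_to_laurent ?r * h = poly_to_laurent (monom 1 (e - 1))"
    unfolding h_def using r0 by (simp del: poly_to_laurent_add)
  have h0: "h \<noteq> 0" using rh by (metis mult_zero_right monom_eq_0_iff poly_to_laurent_eq_0_iff zero_neq_one)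
  have "fls_subdegree (poly_to_laurent ?r * h) = - int e + fls_subdegree h"
    using r0 h0 deg by (subst fls_subdegree_mult) (simp_all del: poly_to_laurent_add)
  then have "fls_subdegree h = 1" unfolding rh using e0 by (simp add: degree_monom_eq)
  then have "fls_order_ge 1 h" by (simp add: fls_order_ge_def)
  then obtain \<Theta> where \<Theta>: "\<Theta> = laurent_subst (monom 1 2) \<Theta> + h" "fls_order_ge 1 \<Theta>"
    using fold_equation_solution by blast
  interpret paperfolding p e d h \<Theta>
    by unfold_locales (use assms e rh \<Theta> in \<open>auto simp: p_def\<close>)
  have "bounded_deficiency (2 * e + 1) \<Theta>"
    unfolding bounded_deficiency_def using no_good_fraction unfolding err_def by (simp add: add_ac)
  then show ?thesis by blast
qed

section \<open>Infinite fields: sequences all of whose Hankel matrices are nonsingular\<close>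

definition hankel_regular :: "(nat \<Rightarrow> 'a::field) \<Rightarrow> nat \<Rightarrow> nat \<Rightarrow> bool" where
  "hankel_regular a v n \<longleftrightarrow>
     (\<forall>M. (\<forall>j\<le>n. (\<Sum>i\<le>n. coeff M i * a (v + i + j)) = 0) \<longrightarrow> degree M \<le> n \<longrightarrow> M = 0)"

text \<open>The matrix has the entries a(v + i + j) with i, j at most n, so v + 2n is the last index
  that occurs.\<close>

lemma hankel_regular_cong:
  assumes "\<And>k. k \<le> v + 2 * n \<Longrightarrow> a k = b k"
  shows "hankel_regular a v n \<longleftrightarrow> hankel_regular b v n"
proof -
  have "(\<Sum>i\<le>n. coeff M i * a (v + i + j)) = (\<Sum>i\<le>n. coeff M i * b (v + i + j))"
    if "j \<le> n" for M :: "'a poly" and j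
    using that by (intro sum.cong) (auto simp: assms)
  then show ?thesis unfolding hankel_regular_def by simp
qed

text \<open>The determinant of the Hankel matrix is an affine function of its last entry, with the
  next smaller Hankel determinant as slope; below, this is expressed by kernel vectors.\<close>

lemma singular_corner_unique:
  fixes f :: "nat \<Rightarrow> 'a::field"
  assumes IH: "n > 0 \<Longrightarrow> hankel_regular f v (n - 1)" and m: "m = v + 2 * n"
    and x: "\<not> hankel_regular (f(m := x)) v n" and y: "\<not> hankel_regular (f(m := y)) v n"
  shows "x = y"
proof -
  \<comment> \<open>With last coefficient zero, \<open>N\<close> lies in the kernel of the next
    smaller Hankel matrix.\<close>
  have key: "N = 0" if N: "degree N \<le> n" "coeff N n = 0"
    "\<And>j. j < n \<Longrightarrow> (\<Sum>i\<le>n. coeff N i * f (v + i + j)) = 0" for N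
  proof (cases n)
    case 0
    then show ?thesis using N(1,2) by (metis le_zero_eq leading_coeff_0_iff)
  next
    case (Suc k)
    have "degree N \<le> k"
      using N(1,2) Suc by (metis coeff_0 degree_0 leading_coeff_0_iff le_SucE le0)
    moreover have "(\<Sum>i\<le>k. coeff N i * f (v + i + j)) = 0" if "j \<le> k" for j
      using N(3)[of j] N(2) that Suc by simp
    ultimately show ?thesis using IH Suc by (auto simp: hankel_regular_def)
  qed
  \<comment> \<open>The changed entry occurs only in row and column \<open>n\<close>: the other rows
    of a kernel vector are unaffected, and the last row is linear in \<open>z\<close> with a
    coefficient that is nonzero by \<open>key\<close>.\<close>
  have ex: "\<exists>M. degree M \<le> n \<and> coeff M n \<noteq> 0 \<and>
      (\<forall>j<n. (\<Sum>i\<le>n. coeff M i * f (v + i + j)) = 0) \<and>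
      coeff M n * z + (\<Sum>i<n. coeff M i * f (v + i + n)) = 0"
    if z: "\<not> hankel_regular (f(m := z)) v n" for z
  proof -
    from z obtain M where M: "degree M \<le> n" "M \<noteq> 0"
      "\<And>j. j \<le> n \<Longrightarrow> (\<Sum>i\<le>n. coeff M i * (f(m := z)) (v + i + j)) = 0"
      unfolding hankel_regular_def by blast
    have 1: "(\<Sum>i\<le>n. coeff M i * f (v + i + j)) = 0" if "j < n" for j
    proof -
      have "(\<Sum>i\<le>n. coeff M i * f (v + i + j)) = (\<Sum>i\<le>n. coeff M i * (f(m := z)) (v + i + j))"
        using that m by (intro sum.cong) auto
      with M(3)[of j] that show ?thesis by simp
    qed
    have "(\<Sum>i\<le>n. coeff M i * (f(m := z)) (v + i + n)) =
        coeff M n * z + (\<Sum>i<n. coeff M i * (f(m := z)) (v + i + n))"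
      by (simp add: m lessThan_Suc_atMost[symmetric] add.commute)
    also have "(\<Sum>i<n. coeff M i * (f(m := z)) (v + i + n)) = (\<Sum>i<n. coeff M i * f (v + i + n))"
      using m by (intro sum.cong) auto
    finally have 2: "coeff M n * z + (\<Sum>i<n. coeff M i * f (v + i + n)) = 0" using M(3)[of n] by simp
    have "coeff M n \<noteq> 0" using key[OF M(1) _ 1] M(2) by blast
    then show ?thesis using M(1) 1 2 by blast
  qed
  obtain M where M: "degree M \<le> n" "coeff M n \<noteq> 0"
    "\<And>j. j < n \<Longrightarrow> (\<Sum>i\<le>n. coeff M i * f (v + i + j)) = 0"
    "coeff M n * x + (\<Sum>i<n. coeff M i * f (v + i + n)) = 0" using ex[OF x] by blast
  obtain M' where M': "degree M' \<le> n" "coeff M' n \<noteq> 0"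
    "\<And>j. j < n \<Longrightarrow> (\<Sum>i\<le>n. coeff M' i * f (v + i + j)) = 0"
    "coeff M' n * y + (\<Sum>i<n. coeff M' i * f (v + i + n)) = 0" using ex[OF y] by blast
  \<comment> \<open>This combination cancels the coefficient at \<open>n\<close>, so
    \<open>key\<close> shows the two kernel vectors to be proportional.\<close>
  let ?N = "smult (coeff M' n) M - smult (coeff M n) M'"
  have lin: "(\<Sum>i\<in>I. coeff ?N i * g i) =
      coeff M' n * (\<Sum>i\<in>I. coeff M i * g i) - coeff M n * (\<Sum>i\<in>I. coeff M' i * g i)" for I g
    by (simp add: sum_distrib_left sum_subtractf algebra_simps)
  have "?N = 0"
  proof (rule key)
    show "degree ?N \<le> n"
      using M(1) M'(1) by (intro degree_diff_le) (auto intro: order_trans[OF degree_smult_le])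
    show "(\<Sum>i\<le>n. coeff ?N i * f (v + i + j)) = 0" if "j < n" for j
      unfolding lin using M(3) M'(3) that by simp
  qed simp
  then have "coeff M' n * (\<Sum>i<n. coeff M i * f (v + i + n)) =
      coeff M n * (\<Sum>i<n. coeff M' i * f (v + i + n))"
    using lin[of "\<lambda>i. f (v + i + n)" "{..<n}"] by simp
  moreover have "(\<Sum>i<n. coeff M i * f (v + i + n)) = - (coeff M n * x)"
    "(\<Sum>i<n. coeff M' i * f (v + i + n)) = - (coeff M' n * y)"
    using M(4) M'(4) by (simp_all add: eq_neg_iff_add_eq_0 add.commute)
  ultimately have "(coeff M n * coeff M' n) * x = (coeff M n * coeff M' n) * y"
    by (simp add: algebra_simps)
  then show ?thesis using M(2) M'(2) by simp
qed

text \<open>The term at \<open>m\<close> is the corner entry of finitely many Hankel matrices, one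
  for each n up to m/2. Each of them excludes at most one value, and the field is infinite.\<close>

lemma regular_sequence_exists:
  assumes "infinite (UNIV :: 'a::field set)"
  shows "\<exists>a :: nat \<Rightarrow> 'a. \<forall>v n. hankel_regular a v n"
proof -
  let ?P = "\<lambda>f m x. \<forall>v n. v + 2 * n = m \<longrightarrow> hankel_regular (f(m := x)) v n"
  have "\<exists>a :: nat \<Rightarrow> 'a. \<forall>m. ?P a m (a m)"
  proof (rule dependent_wellorder_choice)
    fix f g :: "nat \<Rightarrow> 'a" and m x assume fg: "\<And>y. y < m \<Longrightarrow> f y = g y"
    have "hankel_regular (f(m := x)) v n \<longleftrightarrow> hankel_regular (g(m := x)) v n" if "v + 2 * n = m" for v n
      by (rule hankel_regular_cong) (use fg that in auto)
    then show "?P f m x = ?P g m x" by blast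
  next
    fix m and f :: "nat \<Rightarrow> 'a" assume IH: "\<And>y. y < m \<Longrightarrow> ?P f y (f y)"
    let ?B = "\<lambda>n. {x. \<not> hankel_regular (f(m := x)) (m - 2 * n) n}"
    have "finite (?B n)" if "n \<le> m div 2" for n
    proof -
      have "x = y" if "x \<in> ?B n" "y \<in> ?B n" for x y
      proof (rule singular_corner_unique)
        assume "n > 0"
        then show "hankel_regular f (m - 2 * n) (n - 1)"
          using IH[of "m - 2 * n + 2 * (n - 1)"] \<open>n \<le> m div 2\<close> by auto
      qed (use that \<open>n \<le> m div 2\<close> in auto)
      then obtain z where "?B n \<subseteq> {z}" by blast
      then show ?thesis by (rule finite_subset) simp
    qed
    then have "finite (\<Union>n\<le>m div 2. ?B n)" by auto
    then obtain x where x: "x \<notin> (\<Union>n\<le>m div 2. ?B n)" using ex_new_if_finite[OF assms] by blast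
    have "?P f m x"
    proof (intro allI impI)
      fix v n assume "v + 2 * n = m"
      then have "n \<le> m div 2" "v = m - 2 * n" by auto
      with x show "hankel_regular (f(m := x)) v n" by auto
    qed
    then show "\<exists>x. ?P f m x" by blast
  qed
  then show ?thesis by auto
qed

text \<open>The coefficient of t^(-j-1) in Q t^v \<Theta> is row j of the Hankel matrix applied to
  \<open>Q\<close>. Order at least \<open>degree Q + 2\<close> kills the rows 0, ...,
  \<open>degree Q\<close>, which makes \<open>Q\<close> a kernel vector.\<close>

lemma infinite_field_bounded_deficiency:
  assumes "infinite (UNIV :: 'a::field set)"
  shows "\<exists>c (\<Theta> :: 'a fls). bounded_deficiency c \<Theta>"
proof -
  obtain a :: "nat \<Rightarrow> 'a" where a: "\<And>v n. hankel_regular a v n"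
    using regular_sequence_exists[OF assms] by blast
  \<comment> \<open>The factor \<open>fls_X\<close> makes a(k) the coefficient of t^(-k-1), so that
    all of the sequence lies in the fractional part.\<close>
  define \<Theta> where "\<Theta> = fls_X * fps_to_fls (Abs_fps a)"
  have Theta_nth: "fls_nth \<Theta> (int (Suc k)) = a k" for k
    by (simp add: \<Theta>_def fls_X_times_conv_shift)
  have shift: "fls_nth (fls_X_inv ^ k * f) n = fls_nth f (n + int k)" for k n and f :: "'a fls"
    by (simp add: fls_X_inv_power_times_conv_shift)
  have "\<not> fls_order_ge (int (degree Q) + int 2)
      (poly_to_laurent Q * (fls_X_inv ^ v * \<Theta>) - poly_to_laurent R)" if "Q \<noteq> 0" for v Q R
  proof
    assume E: "fls_order_ge (int (degree Q) + int 2)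
      (poly_to_laurent Q * (fls_X_inv ^ v * \<Theta>) - poly_to_laurent R)"
    have "(\<Sum>i\<le>degree Q. coeff Q i * a (v + i + j)) = 0" if "j \<le> degree Q" for j
    proof -
      have Q: "poly_to_laurent Q = (\<Sum>i\<le>degree Q. fls_const (coeff Q i) * fls_X_inv ^ i)"
        using poly_as_sum_of_monoms[of Q] poly_to_laurent_sum[of "\<lambda>i. monom (coeff Q i) i" "{..degree Q}"]
        by (simp add: poly_to_laurent_monom)
      have "(\<Sum>i\<le>degree Q. coeff Q i * a (v + i + j)) =
          fls_nth (poly_to_laurent Q * (fls_X_inv ^ v * \<Theta>)) (int (Suc j))"
        unfolding Q sum_distrib_right fls_nth_sum
        using Theta_nth[of "v + _ + j"]
        by (intro sum.cong) (simp_all add: mult.assoc shift add_ac)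
      also have "\<dots> = fls_nth (poly_to_laurent Q * (fls_X_inv ^ v * \<Theta>) - poly_to_laurent R) (int (Suc j))"
        by (simp add: poly_to_laurent_nth)
      also have "\<dots> = 0" using E that unfolding fls_order_ge_iff_nth by auto
      finally show ?thesis .
    qed
    with a[of v "degree Q"] \<open>Q \<noteq> 0\<close> show False unfolding hankel_regular_def by blast
  qed
  then have "bounded_deficiency 2 \<Theta>" unfolding bounded_deficiency_def by blast
  then show ?thesis by blast
qed

theorem corollary1p1p2:
  fixes P :: "'a::field poly"
  assumes "infinite (UNIV :: 'a set) \<or>
    (finite (UNIV :: 'a set) \<and> (CHAR('a) = 5 \<or> (prime CHAR('a) \<and> CHAR('a) mod 4 = 3)))"
    and "irreducible P"
  shows "\<not> adic_littlewood_conjecture P \<and> (\<exists>\<Theta> :: 'a fls. littlewood_inf P \<Theta> > 0)"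
proof -
  have "\<exists>c (\<Theta> :: 'a fls). bounded_deficiency c \<Theta>"
  proof (cases "infinite (UNIV :: 'a set)")
    case True
    then show ?thesis by (rule infinite_field_bounded_deficiency)
  next
    case False
    with assms(1) have "CHAR('a) = 5 \<or> (prime CHAR('a) \<and> CHAR('a) mod 4 = 3)" by blast
    then have "prime CHAR('a) \<and> odd CHAR('a)" by (auto, presburger)
    then show ?thesis using odd_char_bounded_deficiency by blast
  qed
  then obtain \<Theta> :: "'a fls" where "littlewood_inf P \<Theta> > 0"
    using littlewood_inf_pos[OF assms(2)] by blast
  then show ?thesis unfolding adic_littlewood_conjecture_def by (metis less_irrefl)
qed

end
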